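(* Let $X_1,\dots,X_n$ be i.i.d. random vectors in $\mathbb{R}^d$ with $\mathbb{E}X_k=0$ and $\mathbb{E}|X_{k,i}|^4\le M$ for all $i\in[d]$, with covariance matrix $\Sigma^*=[\sigma^*_{ij}]=\mathbb{E}X_kX_k^T$ that is approximately column-wise sparse: for some $0\le q<1$ and $s>0$, $\sup_{j\in[d]}\sum_{i=1}^d|\sigma^*_{ij}|^q\le s$. For fixed $\delta\ge 4$ and fixed constants $C_4>C_3>0$ set $$\eta=C_3M^{1/4}\Big(\frac{n}{\delta\log d}\Big)^{1/8},\qquad \gamma=C_4M^{1/4}\Big(\frac{n}{\delta\log d}\Big)^{1/8},\qquad \zeta=C_5\sqrt M\Big(\frac{\delta\log d}{n}\Big)^{1/4},$$ where $C_5$ is a sufficiently large constant, and assume that $\delta\log d/n$ is sufficiently small. Let $\widetilde X_k$ be the entrywise truncation of $X_k$ at level $\eta$, $\dot X_{kj}=\mathrm{sign}(\widetilde X_k+\Gamma_{kj})$, $j=1,2$, the dithered 1-bit data with dithering scale $\gamma$, $\breve\Sigma=\frac{\gamma^2}{2n}\sum_{k=1}^n(\dot X_{k1}\dot X_{k2}^T+\dot X_{k2}\dot X_{k1}^T)$, and $\widehat\Sigma=\mathcal{T}_\zeta\breve\Sigma$ its entrywise hard thresholding. Then with $p=\delta/4$, $$\Big(\mathbb{E}\|\widehat\Sigma-\Sigma^*\|_{\mathrm{op}}^p\Big)^{1/p}\lesssim sM^{(1-q)/2}\Big[\frac{\delta\log d}{n}\Big]^{(1-q)/4},$$ and moreover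 $$\mathbb{P}\Big(\|\widehat\Sigma-\Sigma^*\|_{\mathrm{op}}\lesssim sM^{(1-q)/2}\Big[\frac{\delta\log d}{n}\Big]^{(1-q)/4}\Big)\ge 1-\exp(-\delta).$$
   Context: $[d]=\{1,\dots,d\}$; $X_{k,i}$ is the $i$-th entry of $X_k$. $\|\cdot\|_{\mathrm{op}}$ is the operator (spectral) norm. Truncation at level $\eta$: $x\mapsto\mathrm{sign}(x)\min\{|x|,\eta\}$, applied entrywise. $\mathrm{sign}(x)=1$ if $x\ge0$, $-1$ if $x<0$, applied entrywise. Hard thresholding: $\mathcal{T}_\zeta(x)=x\,\mathbf{1}(|x|\ge\zeta)$, applied entrywise. For $q=0$ the sum $\sum_i|\sigma^*_{ij}|^q$ counts the nonzero entries of the $j$-th column. The dithers $\Gamma_{k1},\Gamma_{k2}$ ($k\in[n]$) are i.i.d. uniform on $[-\gamma,\gamma]^d$ and independent of $(X_k)_{k\in[n]}$. $A\lesssim B$ means $A\le KB$ for an absolute constant $K$, where $C_3,C_4,C_5$ are regarded as fixed absolute constants.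
   Formalization: The moment bound (not the probability bound) is stated under (√M(δ log d/n)^{1/4})^q ≤ s, i.e. s ≥ 1 if q = 0 and δ log d/n ≤ s^{4/q}/M² if q > 0; for arbitrary s > 0 it fails, e.g. for X = 0 and s → 0. Also d ≥ 2 is assumed so that log d > 0. *)

theory Defs
  imports "HOL-Probability.Probability"
begin

text \<open>
  The dimension \<open>d\<close> has to be quantified inside the theorem, because the constants there must not
  depend on it.  Vectors of dimension \<open>d\<close> are therefore functions on \<open>{1..d}\<close>, matrices are functions
  of two such indices, and a random vector is a measurable map into \<open>borel_vec d\<close>.
\<close>

definition borel_vec :: "nat \<Rightarrow> (nat \<Rightarrow> real) measure" where
  "borel_vec d = Pi\<^sub>M {1..d} (\<lambda>_. borel)"

definition op_norm :: "nat \<Rightarrow> (nat \<Rightarrow> nat \<Rightarrow> real) \<Rightarrow> real" where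
  "op_norm d A =
     (SUP v\<in>{v. L2_set v {1..d} \<le> 1}. L2_set (\<lambda>i. \<Sum>j=1..d. A i j * v j) {1..d})"

definition bit_sign :: "real \<Rightarrow> real" where
  "bit_sign x = (if 0 \<le> x then 1 else - 1)"

definition truncate_at :: "real \<Rightarrow> real \<Rightarrow> real" where
  "truncate_at \<eta> x = bit_sign x * min \<bar>x\<bar> \<eta>"

definition hard_threshold :: "real \<Rightarrow> real \<Rightarrow> real" where
  "hard_threshold \<zeta> x = (if \<zeta> \<le> \<bar>x\<bar> then x else 0)"

definition one_bit :: "real \<Rightarrow> (nat \<Rightarrow> real) \<Rightarrow> (nat \<Rightarrow> real) \<Rightarrow> nat \<Rightarrow> real" where
  "one_bit \<eta> x g i = bit_sign (truncate_at \<eta> (x i) + g i)"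

text \<open>The sample is \<open>x k\<close> with dithers \<open>g (k, 1)\<close> and \<open>g (k, 2)\<close>, for \<open>k \<in> {1..n}\<close>.\<close>

definition raw_estimator ::
  "real \<Rightarrow> real \<Rightarrow> nat \<Rightarrow> (nat \<Rightarrow> nat \<Rightarrow> real) \<Rightarrow> (nat \<times> nat \<Rightarrow> nat \<Rightarrow> real) \<Rightarrow> nat \<Rightarrow> nat \<Rightarrow> real" where
  "raw_estimator \<eta> \<gamma> n x g i j =
     \<gamma>\<^sup>2 / (2 * real n) *
       (\<Sum>k=1..n. one_bit \<eta> (x k) (g (k, 1)) i * one_bit \<eta> (x k) (g (k, 2)) j
               + one_bit \<eta> (x k) (g (k, 2)) i * one_bit \<eta> (x k) (g (k, 1)) j)"

definition cov_estimator ::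
  "real \<Rightarrow> real \<Rightarrow> real \<Rightarrow> nat \<Rightarrow> (nat \<Rightarrow> nat \<Rightarrow> real) \<Rightarrow> (nat \<times> nat \<Rightarrow> nat \<Rightarrow> real)
    \<Rightarrow> nat \<Rightarrow> nat \<Rightarrow> real" where
  "cov_estimator \<eta> \<gamma> \<zeta> n x g i j = hard_threshold \<zeta> (raw_estimator \<eta> \<gamma> n x g i j)"

text \<open>The covariance matrix of a random vector with mean zero.\<close>

definition centered_cov :: "'a measure \<Rightarrow> ('a \<Rightarrow> nat \<Rightarrow> real) \<Rightarrow> nat \<Rightarrow> nat \<Rightarrow> real" where
  "centered_cov P Y i j = (\<integral>\<omega>. Y \<omega> i * Y \<omega> j \<partial>P)"

definition uniform_cube :: "nat \<Rightarrow> real \<Rightarrow> (nat \<Rightarrow> real) measure" where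
  "uniform_cube d \<gamma> = uniform_measure (Pi\<^sub>M {1..d} (\<lambda>_. lborel)) ({1..d} \<rightarrow>\<^sub>E {-\<gamma>..\<gamma>})"

text \<open>
  Column-wise approximate sparsity.  For \<open>q = 0\<close> the sum counts the nonzero entries of the
  column, since \<open>0 powr 0 = 0\<close>.
\<close>

definition column_sparse :: "nat \<Rightarrow> real \<Rightarrow> real \<Rightarrow> (nat \<Rightarrow> nat \<Rightarrow> real) \<Rightarrow> bool" where
  "column_sparse d q s A \<longleftrightarrow> (SUP j\<in>{1..d}. \<Sum>i=1..d. \<bar>A i j\<bar> powr q) \<le> s"

definition iid_sample :: "'a measure \<Rightarrow> nat \<Rightarrow> nat \<Rightarrow> (nat \<Rightarrow> 'a \<Rightarrow> nat \<Rightarrow> real) \<Rightarrow> bool" where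
  "iid_sample P d n X \<longleftrightarrow>
     prob_space.indep_vars P (\<lambda>_. borel_vec d) X {1..n} \<and>
     (\<forall>k\<in>{1..n}. distr P (borel_vec d) (X k) = distr P (borel_vec d) (X 1))"

definition uniform_dithers ::
  "'a measure \<Rightarrow> nat \<Rightarrow> nat \<Rightarrow> real \<Rightarrow> (nat \<times> nat \<Rightarrow> 'a \<Rightarrow> nat \<Rightarrow> real) \<Rightarrow> bool" where
  "uniform_dithers P d n \<gamma> \<Gamma> \<longleftrightarrow>
     prob_space.indep_vars P (\<lambda>_. borel_vec d) \<Gamma> ({1..n} \<times> {1, 2}) \<and>
     (\<forall>kj\<in>{1..n} \<times> {1, 2}. distr P (borel_vec d) (\<Gamma> kj) = uniform_cube d \<gamma>)"

text \<open>
  Independence of the two families as a whole, not merely of each pair \<open>X k\<close>, \<open>\<Gamma> (l, j)\<close>.  The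
  families have different types, so \<open>indep_var\<close> is replaced by independence of the generated
  sigma-algebras.
\<close>

definition dithers_independent ::
  "'a measure \<Rightarrow> nat \<Rightarrow> nat \<Rightarrow> (nat \<Rightarrow> 'a \<Rightarrow> nat \<Rightarrow> real) \<Rightarrow> (nat \<times> nat \<Rightarrow> 'a \<Rightarrow> nat \<Rightarrow> real)
    \<Rightarrow> bool" where
  "dithers_independent P d n X \<Gamma> \<longleftrightarrow>
     prob_space.indep_set P
       (sets (vimage_algebra (space P) (\<lambda>\<omega>. \<lambda>k\<in>{1..n}. X k \<omega>)
          (Pi\<^sub>M {1..n} (\<lambda>_. borel_vec d))))
       (sets (vimage_algebra (space P) (\<lambda>\<omega>. \<lambda>kj\<in>{1..n} \<times> {1, 2}. \<Gamma> kj \<omega>)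
          (Pi\<^sub>M ({1..n} \<times> {1, 2}) (\<lambda>_. borel_vec d))))"

end

theory Submission
  imports Defs
begin

text \<open>
  A sign dithered by uniform noise on \<open>[-\<gamma>, \<gamma>]\<close> is an unbiased estimate of \<open>x / \<gamma>\<close> for
  \<open>\<bar>x\<bar> \<le> \<gamma>\<close>, and the two dithers are independent, so each entry of the raw estimator is an average
  of independent variables bounded by \<open>\<gamma>\<^sup>2\<close> whose mean is the second moment of the truncated
  data; by the fourth moment bound this mean is off by at most \<open>2 M / \<eta>\<^sup>2\<close>.  With
  \<open>u = \<surd>M (\<delta> log d / n)\<^bsup>1/4\<^esup>\<close>, the bias is \<open>O(u)\<close>, and Hoeffding's lemma bounds an exponential
  moment of \<open>E / u\<close>, for the entrywise error \<open>E\<close>, at a rate proportional to \<open>\<delta> log d\<close>.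

  Deterministically, thresholding at \<open>C5 u\<close> leaves an error of at most a constant times
  \<open>\<bar>\<sigma>\<bar>\<^bsup>q\<^esup> u\<^bsup>1-q\<^esup>\<close> plus a constant times \<open>E 1(E > C u)\<close>.  The Schur test sums the first part to the rate.
  As \<open>y \<le> exp (y - 1)\<close>, the exponential moment controls the probability that the second part does not
  vanish as well as its \<open>p\<close>-th moment, with a factor \<open>d\<close> to a negative multiple of \<open>\<delta>\<close> that absorbs
  the sum over the \<open>d\<^sup>2\<close> entries.
\<close>

section \<open>Operator norm and hard thresholding\<close>

lemma op_norm_cong:
  assumes "\<And>i j. i \<in> {1..d} \<Longrightarrow> j \<in> {1..d} \<Longrightarrow> A i j = B i j"
  shows "op_norm d A = op_norm d B"
proof -
  have "L2_set (\<lambda>i. \<Sum>j=1..d. A i j * v j) {1..d} = L2_set (\<lambda>i. \<Sum>j=1..d. B i j * v j) {1..d}"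
    for v :: "nat \<Rightarrow> real"
    using assms by (intro L2_set_cong sum.cong refl) auto
  then show ?thesis by (simp add: op_norm_def)
qed

text \<open>Schur test: each weight \<open>\<bar>A i j\<bar>\<close> is split into two square roots
  for Cauchy-Schwarz, which uses the row bound; after exchanging the sums, the column bound gives
  the second factor \<open>B\<close>.\<close>

lemma L2_set_matrix_vector_le:
  fixes A :: "'i \<Rightarrow> 'j \<Rightarrow> real"
  assumes row: "\<And>i. i \<in> I \<Longrightarrow> (\<Sum>j\<in>J. \<bar>A i j\<bar>) \<le> B"
    and col: "\<And>j. j \<in> J \<Longrightarrow> (\<Sum>i\<in>I. \<bar>A i j\<bar>) \<le> B"
    and B: "0 \<le> B"
  shows "L2_set (\<lambda>i. \<Sum>j\<in>J. A i j * v j) I \<le> B * L2_set v J"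
proof -
  have entry: "(\<Sum>j\<in>J. A i j * v j)\<^sup>2 \<le> B * (\<Sum>j\<in>J. \<bar>A i j\<bar> * (v j)\<^sup>2)" if "i \<in> I" for i
  proof -
    have "\<bar>\<Sum>j\<in>J. A i j * v j\<bar> \<le> (\<Sum>j\<in>J. sqrt \<bar>A i j\<bar> * (sqrt \<bar>A i j\<bar> * \<bar>v j\<bar>))"
      by (rule order.trans[OF sum_abs])
         (auto simp: abs_mult simp flip: mult.assoc intro!: sum_mono)
    then have "(\<Sum>j\<in>J. A i j * v j)\<^sup>2 \<le> (\<Sum>j\<in>J. sqrt \<bar>A i j\<bar> * (sqrt \<bar>A i j\<bar> * \<bar>v j\<bar>))\<^sup>2"
      by (subst abs_le_square_iff[symmetric]) linarith
    also have "\<dots> \<le> (\<Sum>j\<in>J. (sqrt \<bar>A i j\<bar>)\<^sup>2) * (\<Sum>j\<in>J. (sqrt \<bar>A i j\<bar> * \<bar>v j\<bar>)\<^sup>2)"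
      by (rule Cauchy_Schwarz_ineq_sum)
    also have "\<dots> = (\<Sum>j\<in>J. \<bar>A i j\<bar>) * (\<Sum>j\<in>J. \<bar>A i j\<bar> * (v j)\<^sup>2)"
      by (simp add: power_mult_distrib)
    also have "\<dots> \<le> B * (\<Sum>j\<in>J. \<bar>A i j\<bar> * (v j)\<^sup>2)"
      using row[OF that] by (intro mult_right_mono sum_nonneg) auto
    finally show ?thesis .
  qed
  have "(\<Sum>i\<in>I. (\<Sum>j\<in>J. A i j * v j)\<^sup>2) \<le> (\<Sum>i\<in>I. B * (\<Sum>j\<in>J. \<bar>A i j\<bar> * (v j)\<^sup>2))"
    by (intro sum_mono entry)
  also have "\<dots> = B * (\<Sum>j\<in>J. (\<Sum>i\<in>I. \<bar>A i j\<bar>) * (v j)\<^sup>2)"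
    by (subst sum_distrib_left[symmetric], subst sum.swap) (simp add: sum_distrib_right)
  also have "\<dots> \<le> B * (\<Sum>j\<in>J. B * (v j)\<^sup>2)"
    using col B by (intro mult_left_mono sum_mono mult_right_mono) auto
  also have "\<dots> = B\<^sup>2 * (\<Sum>j\<in>J. (v j)\<^sup>2)"
    by (simp add: sum_distrib_left power2_eq_square mult.assoc)
  finally have "sqrt (\<Sum>i\<in>I. (\<Sum>j\<in>J. A i j * v j)\<^sup>2) \<le> sqrt (B\<^sup>2 * (\<Sum>j\<in>J. (v j)\<^sup>2))"
    by simp
  then show ?thesis using B by (simp add: L2_set_def real_sqrt_mult)
qed

lemma op_norm_le_schur:
  assumes "\<And>i. i \<in> {1..d} \<Longrightarrow> (\<Sum>j=1..d. \<bar>A i j\<bar>) \<le> B"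
    and "\<And>j. j \<in> {1..d} \<Longrightarrow> (\<Sum>i=1..d. \<bar>A i j\<bar>) \<le> B" and "0 \<le> B"
  shows "op_norm d A \<le> B"
  unfolding op_norm_def
proof (rule cSUP_least)
  have "L2_set (\<lambda>_. 0::real) {1..d} \<le> 1" by (simp add: L2_set_def)
  then show "{v. L2_set v {1..d} \<le> 1} \<noteq> ({} :: (nat \<Rightarrow> real) set)" by blast
next
  fix v :: "nat \<Rightarrow> real"
  assume "v \<in> {v. L2_set v {1..d} \<le> 1}"
  then have "L2_set v {1..d} \<le> 1" by simp
  then show "L2_set (\<lambda>i. \<Sum>j=1..d. A i j * v j) {1..d} \<le> B"
    using L2_set_matrix_vector_le[of "{1..d}" A "{1..d}" B v, OF assms] \<open>0 \<le> B\<close>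
    by (meson dual_order.trans mult_left_le)
qed

text \<open>The zero vector contributes 0, but a real supremum dominates its members only if they
  are bounded above. The sum of all absolute entries bounds every row and column sum, so the Schur
  test provides this.\<close>

lemma op_norm_nonneg: "0 \<le> op_norm d A"
proof -
  define B where "B = (\<Sum>i=1..d. \<Sum>j=1..d. \<bar>A i j\<bar>)"
  have row: "(\<Sum>j=1..d. \<bar>A i j\<bar>) \<le> B" if "i \<in> {1..d}" for i
    unfolding B_def using that by (intro member_le_sum[of i _ "\<lambda>i. \<Sum>j=1..d. \<bar>A i j\<bar>"]) (auto intro: sum_nonneg)
  have col: "(\<Sum>i=1..d. \<bar>A i j\<bar>) \<le> B" if "j \<in> {1..d}" for j
    unfolding B_def using that by (subst sum.swap, intro member_le_sum[of j _ "\<lambda>j. \<Sum>i=1..d. \<bar>A i j\<bar>"]) (auto intro: sum_nonneg)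
  have B: "0 \<le> B" unfolding B_def by (intro sum_nonneg) auto
  have "bdd_above ((\<lambda>v. L2_set (\<lambda>i. \<Sum>j=1..d. A i j * v j) {1..d}) ` {v. L2_set v {1..d} \<le> 1})"
  proof (rule bdd_aboveI2)
    fix v :: "nat \<Rightarrow> real"
    assume "v \<in> {v. L2_set v {1..d} \<le> 1}"
    then have "L2_set v {1..d} \<le> 1" by simp
    then show "L2_set (\<lambda>i. \<Sum>j=1..d. A i j * v j) {1..d} \<le> B"
      using L2_set_matrix_vector_le[of "{1..d}" A "{1..d}" B v, OF row col B] B
      by (meson dual_order.trans mult_left_le)
  qed
  then show ?thesis
    unfolding op_norm_def
    by (rule cSUP_upper2[where x="\<lambda>_. 0"]) (auto simp: L2_set_def)
qed

section \<open>Error of hard thresholding\<close>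

text \<open>Three cases. If \<open>r\<close> is far from \<open>\<sigma>\<close>, the threshold
  itself is at most \<open>C5 * \<bar>r - \<sigma>\<bar>\<close>. If \<open>r\<close> is close and
  kept, then \<open>u \<le> \<bar>\<sigma>\<bar>\<close>, so part of an error of order
  \<open>u\<close> can be exchanged for \<open>\<bar>\<sigma>\<bar> powr q\<close>. If
  \<open>r\<close> is close and removed, the error is \<open>\<bar>\<sigma>\<bar>\<close>, which is
  at most of order \<open>u\<close>, and its power \<open>1 - q\<close> is exchanged for that of
  \<open>u\<close>.\<close>

lemma hard_threshold_error_le:
  fixes r \<sigma> u C C5 q :: real
  assumes u: "0 < u" and C: "1 \<le> C" and C5: "2 * C \<le> C5" and q: "0 \<le> q" "q < 1"
  shows "\<bar>hard_threshold (C5 * u) r - \<sigma>\<bar> \<le> (C + C5) * u powr (1 - q) * \<bar>\<sigma>\<bar> powr q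
           + (if C * u < \<bar>r - \<sigma>\<bar> then (1 + C5) * \<bar>r - \<sigma>\<bar> else 0)"
proof (cases "C * u < \<bar>r - \<sigma>\<bar>")
  case True
  have "u \<le> C * u" using u C by simp
  then have "u \<le> \<bar>r - \<sigma>\<bar>" using True by linarith
  then have "C5 * u \<le> C5 * \<bar>r - \<sigma>\<bar>" using C C5 by (intro mult_left_mono) auto
  moreover have "\<bar>r - \<sigma>\<bar> \<le> (1 + C5) * \<bar>r - \<sigma>\<bar>"
    using C C5 by (intro mult_left_le_one_le[of _ "1"] mult_le_cancel_right1[THEN iffD2]) auto
  ultimately have "\<bar>hard_threshold (C5 * u) r - \<sigma>\<bar> \<le> (1 + C5) * \<bar>r - \<sigma>\<bar>"
    by (auto simp: hard_threshold_def algebra_simps abs_if split: if_splits)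
  moreover have "0 \<le> (C + C5) * u powr (1 - q) * \<bar>\<sigma>\<bar> powr q" using C C5 by simp
  ultimately show ?thesis using True by simp
next
  case False
  show ?thesis
  proof (cases "C5 * u \<le> \<bar>r\<bar>")
    case True
    have "u \<le> C * u" using u C by simp
    moreover have "2 * (C * u) \<le> C5 * u"
      using mult_right_mono[OF C5, of u] u by (simp add: mult.assoc)
    ultimately have s: "u \<le> \<bar>\<sigma>\<bar>" using True False by linarith
    have "C * u = C * (u powr (1 - q) * u powr q)"
      using u by (simp flip: powr_add)
    also have "\<dots> \<le> (C + C5) * (u powr (1 - q) * \<bar>\<sigma>\<bar> powr q)"
      using s u C C5 q by (intro mult_mono powr_mono2) auto
    finally show ?thesis using True False by (simp add: hard_threshold_def mult.assoc)
  next
    case small: False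
    have le: "\<bar>\<sigma>\<bar> \<le> (C + C5) * u" using small False by (simp add: algebra_simps)
    \<comment> \<open>At \<open>\<sigma> = 0\<close> this holds for \<open>q = 0\<close> too,
      because \<open>0 powr 0 = 0\<close>.\<close>
    have "\<bar>\<sigma>\<bar> = \<bar>\<sigma>\<bar> powr (1 - q) * \<bar>\<sigma>\<bar> powr q"
      by (cases "\<sigma> = 0") (auto simp flip: powr_add)
    also have "\<dots> \<le> ((C + C5) * u) powr (1 - q) * \<bar>\<sigma>\<bar> powr q"
      using le q by (intro mult_right_mono powr_mono2) auto
    also have "\<dots> = (C + C5) powr (1 - q) * u powr (1 - q) * \<bar>\<sigma>\<bar> powr q"
      using u C C5 by (simp add: powr_mult)
    \<comment> \<open>The base \<open>C + C5\<close> is at least 1, so raising its exponent from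
      \<open>1 - q\<close> to 1 does not decrease it.\<close>
    also have "\<dots> \<le> (C + C5) * u powr (1 - q) * \<bar>\<sigma>\<bar> powr q"
      using powr_mono[of "1 - q" 1 "C + C5"] C C5 q by (intro mult_right_mono) auto
    finally show ?thesis using small False by (simp add: hard_threshold_def)
  qed
qed

lemma powr_add_le_double:
  fixes a b p :: real
  assumes "0 \<le> a" "0 \<le> b" "0 \<le> p"
  shows "(a + b) powr p \<le> (2 * a) powr p + (2 * b) powr p"
proof (cases "a \<le> b")
  case True
  then have "(a + b) powr p \<le> (2 * b) powr p" using assms by (intro powr_mono2) auto
  then show ?thesis by (simp add: add_increasing)
next
  case False
  then have "(a + b) powr p \<le> (2 * a) powr p" using assms by (intro powr_mono2) auto
  then show ?thesis by (simp add: add_increasing2)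
qed

text \<open>A pathwise bound, so that only \<open>T\<close> has to be integrated later. Each
  exceptional entry is at most a constant times \<open>u * m\<close>, where \<open>m\<close> is the
  \<open>p\<close>-th root of the sum of all \<open>T i j\<close>. Their total costs a factor
  \<open>(real d)\<^sup>2\<close>, and its \<open>p\<close>-th power is linear in the sum of the
  \<open>T i j\<close>.\<close>

lemma op_norm_hard_threshold_error_powr_le:
  fixes R S :: "nat \<Rightarrow> nat \<Rightarrow> real" and u C C5 q s p l :: real
  assumes u: "0 < u" and C: "1 \<le> C" and C5: "2 * C \<le> C5" and q: "0 \<le> q" "q < 1"
    and p: "0 < p" and l: "p \<le> l * C" and s: "0 \<le> s"
    and row: "\<And>i. i \<in> {1..d} \<Longrightarrow> (\<Sum>j=1..d. \<bar>S i j\<bar> powr q) \<le> s"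
    and col: "\<And>j. j \<in> {1..d} \<Longrightarrow> (\<Sum>i=1..d. \<bar>S i j\<bar> powr q) \<le> s"
  defines "T \<equiv> \<lambda>i j. exp (l * (\<bar>R i j - S i j\<bar> / u - C))"
  shows "op_norm d (\<lambda>i j. hard_threshold (C5 * u) (R i j) - S i j) powr p
    \<le> (2 * ((C + C5) * u powr (1 - q) * s)) powr p
      + (2 * (1 + C5) * C * u * (real d)\<^sup>2) powr p * (\<Sum>i=1..d. \<Sum>j=1..d. T i j)"
proof -
  define a where "a = (C + C5) * u powr (1 - q) * s"
  define m where "m = (\<Sum>i=1..d. \<Sum>j=1..d. T i j) powr (1 / p)"
  define z where "z = (\<lambda>i j. if C * u < \<bar>R i j - S i j\<bar> then (1 + C5) * \<bar>R i j - S i j\<bar> else 0)"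
  define w where "w = (1 + C5) * C * u * (real d)\<^sup>2 * m"
  have Tpos: "0 \<le> T i j" for i j by (simp add: T_def)
  have a0: "0 \<le> a" unfolding a_def using C C5 s by simp
  have m0: "0 \<le> m" unfolding m_def by simp
  have w0: "0 \<le> w" unfolding w_def using C C5 u m0 by simp
  have z0: "0 \<le> z i j" for i j using C C5 by (simp add: z_def)
  have z_le: "z i j \<le> (1 + C5) * C * u * m" if "i \<in> {1..d}" "j \<in> {1..d}" for i j
  proof (cases "C * u < \<bar>R i j - S i j\<bar>")
    case True
    define y where "y = \<bar>R i j - S i j\<bar> / (C * u)"
    have y: "1 < y" using True u C by (simp add: y_def)
    have eq: "\<bar>R i j - S i j\<bar> = C * u * y" using u C by (simp add: y_def)
    \<comment> \<open>This lets a single exponential moment control both the tail and the \<open>p\<close>-th moment.\<close>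
    have "y \<le> exp (y - 1)" using exp_ge_add_one_self[of "y - 1"] by simp
    \<comment> \<open>By \<open>p \<le> l * C\<close> the factor of \<open>y - 1\<close> is at least
      1.\<close>
    also have "\<dots> \<le> exp (l * C * (y - 1) / p)"
      using mult_right_mono[OF l, of "y - 1"] y p by (simp add: field_simps)
    also have "\<dots> = T i j powr (1 / p)"
      using u C p by (simp add: T_def eq powr_def field_simps)
    also have "\<dots> \<le> m"
    proof -
      have "T i j \<le> (\<Sum>j=1..d. T i j)" using that Tpos by (intro member_le_sum) auto
      also have "\<dots> \<le> (\<Sum>i=1..d. \<Sum>j=1..d. T i j)"
        using that Tpos by (intro member_le_sum[of i _ "\<lambda>i. \<Sum>j=1..d. T i j"]) (auto intro: sum_nonneg)
      finally show ?thesis unfolding m_def using p Tpos by (intro powr_mono2) auto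
    qed
    finally have "(1 + C5) * (C * u) * y \<le> (1 + C5) * (C * u) * m"
      using C C5 u by (intro mult_left_mono) auto
    then show ?thesis using True by (simp add: z_def eq mult.assoc)
  qed (use C C5 u m0 in \<open>simp add: z_def\<close>)
  have Z: "(\<Sum>i=1..d. \<Sum>j=1..d. z i j) \<le> w"
  proof -
    have "(\<Sum>i=1..d. \<Sum>j=1..d. z i j) \<le> (\<Sum>i=1..d. \<Sum>j=1..d. (1 + C5) * C * u * m)"
      by (intro sum_mono z_le) auto
    then show ?thesis by (simp add: w_def power2_eq_square mult_ac)
  qed
  have D: "\<bar>hard_threshold (C5 * u) (R i j) - S i j\<bar>
      \<le> (C + C5) * u powr (1 - q) * \<bar>S i j\<bar> powr q + z i j" for i j
    unfolding z_def by (rule hard_threshold_error_le[OF u C C5 q])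
  have "op_norm d (\<lambda>i j. hard_threshold (C5 * u) (R i j) - S i j) \<le> a + w"
  proof (rule op_norm_le_schur)
    fix i assume i: "i \<in> {1..d}"
    have "(\<Sum>j=1..d. \<bar>hard_threshold (C5 * u) (R i j) - S i j\<bar>)
        \<le> (C + C5) * u powr (1 - q) * (\<Sum>j=1..d. \<bar>S i j\<bar> powr q) + (\<Sum>j=1..d. z i j)"
      by (rule order.trans[OF sum_mono[OF D]]) (simp add: sum.distrib sum_distrib_left)
    also have "\<dots> \<le> a + (\<Sum>i=1..d. \<Sum>j=1..d. z i j)"
      unfolding a_def using C C5 i z0
      by (intro add_mono mult_left_mono row member_le_sum[of i _ "\<lambda>i. \<Sum>j=1..d. z i j"])
         (auto intro: sum_nonneg)
    finally show "(\<Sum>j=1..d. \<bar>hard_threshold (C5 * u) (R i j) - S i j\<bar>) \<le> a + w"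
      using Z by linarith
  next
    fix j assume j: "j \<in> {1..d}"
    have "(\<Sum>i=1..d. \<bar>hard_threshold (C5 * u) (R i j) - S i j\<bar>)
        \<le> (C + C5) * u powr (1 - q) * (\<Sum>i=1..d. \<bar>S i j\<bar> powr q) + (\<Sum>i=1..d. z i j)"
      by (rule order.trans[OF sum_mono[OF D]]) (simp add: sum.distrib sum_distrib_left)
    also have "\<dots> \<le> a + (\<Sum>j=1..d. \<Sum>i=1..d. z i j)"
      unfolding a_def using C C5 j z0
      by (intro add_mono mult_left_mono col member_le_sum[of j _ "\<lambda>j. \<Sum>i=1..d. z i j"])
         (auto intro: sum_nonneg)
    also have "(\<Sum>j=1..d. \<Sum>i=1..d. z i j) = (\<Sum>i=1..d. \<Sum>j=1..d. z i j)"
      by (rule sum.swap)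
    finally show "(\<Sum>i=1..d. \<bar>hard_threshold (C5 * u) (R i j) - S i j\<bar>) \<le> a + w"
      using Z by linarith
  qed (use a0 w0 in simp)
  then have "op_norm d (\<lambda>i j. hard_threshold (C5 * u) (R i j) - S i j) powr p \<le> (a + w) powr p"
    using p op_norm_nonneg by (intro powr_mono2) auto
  also have "\<dots> \<le> (2 * a) powr p + (2 * w) powr p"
    using a0 w0 p by (intro powr_add_le_double) auto
  also have "(2 * w) powr p = (2 * (1 + C5) * C * u * (real d)\<^sup>2 * m) powr p"
    by (simp add: w_def algebra_simps)
  also have "\<dots> = (2 * (1 + C5) * C * u * (real d)\<^sup>2) powr p * m powr p"
    using C C5 u m0 by (intro powr_mult)
  also have "m powr p = (\<Sum>i=1..d. \<Sum>j=1..d. T i j)"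
    using p Tpos by (simp add: m_def powr_powr sum_nonneg)
  finally show ?thesis by (simp add: a_def)
qed

text \<open>The case without exceptional entries; it serves the bound in probability, and the
  preceding lemma serves the moments.\<close>

lemma op_norm_hard_threshold_error_le:
  fixes R S :: "nat \<Rightarrow> nat \<Rightarrow> real" and u C C5 q s :: real
  assumes u: "0 < u" and C: "1 \<le> C" and C5: "2 * C \<le> C5" and q: "0 \<le> q" "q < 1"
    and s: "0 \<le> s"
    and row: "\<And>i. i \<in> {1..d} \<Longrightarrow> (\<Sum>j=1..d. \<bar>S i j\<bar> powr q) \<le> s"
    and col: "\<And>j. j \<in> {1..d} \<Longrightarrow> (\<Sum>i=1..d. \<bar>S i j\<bar> powr q) \<le> s"
    and close: "\<And>i j. i \<in> {1..d} \<Longrightarrow> j \<in> {1..d} \<Longrightarrow> \<bar>R i j - S i j\<bar> \<le> C * u"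
  shows "op_norm d (\<lambda>i j. hard_threshold (C5 * u) (R i j) - S i j)
    \<le> (C + C5) * u powr (1 - q) * s"
proof (rule op_norm_le_schur)
  have D: "\<bar>hard_threshold (C5 * u) (R i j) - S i j\<bar>
      \<le> (C + C5) * u powr (1 - q) * \<bar>S i j\<bar> powr q" if "i \<in> {1..d}" "j \<in> {1..d}" for i j
    using hard_threshold_error_le[OF u C C5 q, of "R i j" "S i j"] close[OF that] by simp
  show "(\<Sum>j=1..d. \<bar>hard_threshold (C5 * u) (R i j) - S i j\<bar>) \<le> (C + C5) * u powr (1 - q) * s"
    if i: "i \<in> {1..d}" for i
  proof -
    have "(\<Sum>j=1..d. \<bar>hard_threshold (C5 * u) (R i j) - S i j\<bar>)
        \<le> (\<Sum>j=1..d. (C + C5) * u powr (1 - q) * \<bar>S i j\<bar> powr q)"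
      using i by (intro sum_mono D)
    also have "\<dots> \<le> (C + C5) * u powr (1 - q) * s"
      unfolding sum_distrib_left[symmetric] using C C5 i by (intro mult_left_mono row) auto
    finally show ?thesis .
  qed
  show "(\<Sum>i=1..d. \<bar>hard_threshold (C5 * u) (R i j) - S i j\<bar>) \<le> (C + C5) * u powr (1 - q) * s"
    if j: "j \<in> {1..d}" for j
  proof -
    have "(\<Sum>i=1..d. \<bar>hard_threshold (C5 * u) (R i j) - S i j\<bar>)
        \<le> (\<Sum>i=1..d. (C + C5) * u powr (1 - q) * \<bar>S i j\<bar> powr q)"
      using j by (intro sum_mono D)
    also have "\<dots> \<le> (C + C5) * u powr (1 - q) * s"
      unfolding sum_distrib_left[symmetric] using C C5 j by (intro mult_left_mono col) auto
    finally show ?thesis .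
  qed
qed (use C C5 s in simp)

section \<open>Dithered one-bit samples\<close>

lemma measurable_bit_sign [measurable]: "bit_sign \<in> borel_measurable borel"
  unfolding bit_sign_def[abs_def] by measurable

lemma measurable_truncate_at [measurable]: "truncate_at \<eta> \<in> borel_measurable borel"
  unfolding truncate_at_def[abs_def] by measurable

lemma measurable_borel_vec_component [measurable]:
  "i \<in> {1..d} \<Longrightarrow> (\<lambda>x. x i) \<in> borel_measurable (borel_vec d)"
  unfolding borel_vec_def by (rule measurable_component_singleton)

lemma measurable_PiM_borel_vec_component:
  assumes "kj \<in> J" and "i \<in> {1..d}"
  shows "(\<lambda>z. z kj i) \<in> borel_measurable (Pi\<^sub>M J (\<lambda>_. borel_vec d))"
  by (rule measurable_compose[where f="\<lambda>z. z kj" and N="borel_vec d"])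
     (use assms in \<open>simp_all add: measurable_borel_vec_component\<close>)

lemma abs_bit_sign [simp]: "\<bar>bit_sign x\<bar> = 1"
  by (simp add: bit_sign_def)

lemma abs_one_bit [simp]: "\<bar>one_bit \<eta> x g i\<bar> = 1"
  by (simp add: one_bit_def)

lemma abs_truncate_at_le: "0 \<le> \<eta> \<Longrightarrow> \<bar>truncate_at \<eta> x\<bar> \<le> \<eta>"
  by (simp add: truncate_at_def abs_mult)

lemma truncate_at_eq_self: "\<bar>x\<bar> \<le> \<eta> \<Longrightarrow> truncate_at \<eta> x = x"
  by (auto simp: truncate_at_def bit_sign_def)

text \<open>Nothing is lost unless some argument exceeds \<open>\<eta>\<close> in modulus. Then the
  larger modulus \<open>m\<close> does, and as truncation keeps signs and shrinks moduli, the loss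
  is at most \<open>m * m \<le> m ^ 4 / \<eta>\<^sup>2\<close>.\<close>

lemma abs_mult_diff_truncate_at_le:
  assumes "0 < \<eta>"
  shows "\<bar>x * y - truncate_at \<eta> x * truncate_at \<eta> y\<bar> \<le> (abs x ^ 4 + abs y ^ 4) / \<eta>\<^sup>2"
proof (cases "abs x \<le> \<eta> \<and> abs y \<le> \<eta>")
  case True
  then show ?thesis using assms by (simp add: truncate_at_eq_self)
next
  case False
  define m where "m = max (abs x) (abs y)"
  have m: "\<eta> \<le> m" using False by (auto simp: m_def)
  have tr: "truncate_at \<eta> x * truncate_at \<eta> y
      = (bit_sign x * bit_sign y) * (min (abs x) \<eta> * min (abs y) \<eta>)"
    by (simp add: truncate_at_def)
  have xy: "x * y = (bit_sign x * bit_sign y) * (abs x * abs y)"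
    by (simp add: bit_sign_def)
  have "\<bar>x * y - truncate_at \<eta> x * truncate_at \<eta> y\<bar>
      = \<bar>abs x * abs y - min (abs x) \<eta> * min (abs y) \<eta>\<bar>"
    unfolding tr xy right_diff_distrib[symmetric] by (simp add: abs_mult)
  also have "\<dots> \<le> abs x * abs y"
  proof -
    have "min (abs x) \<eta> * min (abs y) \<eta> \<le> abs x * abs y" using assms by (intro mult_mono) auto
    moreover have "0 \<le> min (abs x) \<eta> * min (abs y) \<eta>" using assms by simp
    ultimately show ?thesis by linarith
  qed
  also have "\<dots> \<le> m * m" unfolding m_def by (intro mult_mono) auto
  also have "\<dots> \<le> m ^ 4 / \<eta>\<^sup>2"
  proof -
    have "m * m * \<eta>\<^sup>2 \<le> m * m * m\<^sup>2" using m assms by (intro mult_left_mono power_mono) auto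
    then show ?thesis using assms by (simp add: field_simps eval_nat_numeral)
  qed
  also have "\<dots> \<le> (abs x ^ 4 + abs y ^ 4) / \<eta>\<^sup>2"
    by (intro divide_right_mono) (auto simp: m_def max_def)
  finally show ?thesis .
qed

section \<open>The uniform law on the cube\<close>

lemma emeasure_PiM_lborel_PiE_interval:
  fixes l u :: "nat \<Rightarrow> real"
  assumes "finite I" and "\<And>i. i \<in> I \<Longrightarrow> l i \<le> u i"
  shows "emeasure (Pi\<^sub>M I (\<lambda>_. lborel)) (\<Pi>\<^sub>E i\<in>I. {l i..u i}) = ennreal (\<Prod>i\<in>I. u i - l i)"
proof -
  interpret product_sigma_finite "\<lambda>_. lborel :: real measure" ..
  have "emeasure (Pi\<^sub>M I (\<lambda>_. lborel)) (\<Pi>\<^sub>E i\<in>I. {l i..u i}) = (\<Prod>i\<in>I. ennreal (u i - l i))"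
    using assms by (subst emeasure_PiM) auto
  then show ?thesis using assms by (simp add: prod_ennreal)
qed

lemma sets_uniform_cube: "sets (uniform_cube d \<gamma>) = sets (borel_vec d)"
  unfolding uniform_cube_def borel_vec_def by (auto intro!: sets_PiM_cong)

text \<open>
  Since \<open>0 / 0 = 0\<close> for \<open>ennreal\<close>, \<open>uniform_cube d 0\<close> is the zero measure and not a point mass.
  Hence no dithers exist at scale \<open>0\<close>, which excludes \<open>M = 0\<close> in the theorem.
\<close>

lemma emeasure_uniform_cube_0:
  assumes "1 \<le> d"
  shows "emeasure (uniform_cube d 0) A = 0"
proof (cases "A \<in> sets (uniform_cube d 0)")
  case True
  define Q where "Q = ({1..d} \<rightarrow>\<^sub>E {-(0::real)..0})"
  have Q: "Q \<in> sets (Pi\<^sub>M {1..d} (\<lambda>_. lborel))"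
    unfolding Q_def by (intro sets_PiM_I_finite) auto
  have "emeasure (Pi\<^sub>M {1..d} (\<lambda>_. lborel)) Q = 0"
    unfolding Q_def
    using emeasure_PiM_lborel_PiE_interval[of "{1..d}" "\<lambda>_. 0" "\<lambda>_. 0"] assms by simp
  then have "emeasure (Pi\<^sub>M {1..d} (\<lambda>_. lborel)) (Q \<inter> A) = 0"
    by (rule emeasure_eq_0[OF Q]) simp
  moreover have "A \<in> sets (Pi\<^sub>M {1..d} (\<lambda>_. lborel))"
    using True by (simp add: uniform_cube_def)
  ultimately show ?thesis
    unfolding uniform_cube_def Q_def[symmetric] by (simp add: emeasure_uniform_measure[OF Q] del: One_nat_def)
qed (simp add: emeasure_notin_sets)

text \<open>The half-space cuts the cube in a box whose side \<open>i\<close> has length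
  \<open>\<gamma> + x\<close> instead of \<open>2 * \<gamma>\<close>; all other sides cancel in the
  ratio.\<close>

lemma measure_uniform_cube_component_ge:
  assumes i: "i \<in> {1..d}" and x: "\<bar>x\<bar> \<le> \<gamma>" and \<gamma>: "0 < \<gamma>"
  shows "measure (uniform_cube d \<gamma>) {g \<in> space (borel_vec d). -x \<le> g i} = (\<gamma> + x) / (2 * \<gamma>)"
proof -
  let ?L = "Pi\<^sub>M {1..d} (\<lambda>_. lborel :: real measure)"
  define Q where "Q = ({1..d} \<rightarrow>\<^sub>E {-\<gamma>..\<gamma>})"
  define H where "H = {g \<in> space (borel_vec d). -x \<le> g i}"
  define l where "l = (\<lambda>m. if m = i then -x else -\<gamma>)"
  have Q: "emeasure ?L Q = ennreal (\<Prod>m=1..d. 2 * \<gamma>)"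
    unfolding Q_def using emeasure_PiM_lborel_PiE_interval[of "{1..d}" "\<lambda>_. -\<gamma>" "\<lambda>_. \<gamma>"] \<gamma> by simp
  have "Q \<inter> H = (\<Pi>\<^sub>E m\<in>{1..d}. {l m..\<gamma>})"
  proof (intro set_eqI iffI)
    fix g assume g: "g \<in> Q \<inter> H"
    then show "g \<in> (\<Pi>\<^sub>E m\<in>{1..d}. {l m..\<gamma>})"
      by (auto simp: Q_def H_def l_def PiE_iff)
  next
    fix g assume g: "g \<in> (\<Pi>\<^sub>E m\<in>{1..d}. {l m..\<gamma>})"
    have gm: "l m \<le> g m" "g m \<le> \<gamma>" if "m \<in> {1..d}" for m
      using PiE_mem[OF g that] by simp_all
    have lm: "-\<gamma> \<le> l m" for m using x by (auto simp: l_def)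
    have "g \<in> Q"
      unfolding Q_def
    proof (rule PiE_I)
      show "g m \<in> {-\<gamma>..\<gamma>}" if "m \<in> {1..d}" for m
        using gm[OF that] order.trans[OF lm gm(1)[OF that]] by simp
      show "g m = undefined" if "m \<notin> {1..d}" for m
        using PiE_arb[OF g that] .
    qed
    moreover have "-x \<le> g i" using gm(1)[OF i] by (simp add: l_def)
    moreover have "g \<in> space (borel_vec d)"
      using g by (simp add: borel_vec_def space_PiM PiE_iff)
    ultimately show "g \<in> Q \<inter> H" by (simp add: H_def)
  qed
  have "emeasure ?L (Q \<inter> H) = ennreal (\<Prod>m=1..d. \<gamma> - l m)"
  proof -
    have "l m \<le> \<gamma>" for m using x \<gamma> by (auto simp: l_def)
    then show ?thesis
      using \<open>Q \<inter> H = _\<close> emeasure_PiM_lborel_PiE_interval[of "{1..d}" l "\<lambda>_. \<gamma>"] by simp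
  qed
  also have "(\<Prod>m=1..d. \<gamma> - l m) = (\<gamma> + x) * (\<Prod>m\<in>{1..d}-{i}. 2 * \<gamma>)"
    using i by (subst prod.remove[of _ i]) (auto simp: l_def intro!: prod.cong)
  finally have QH: "emeasure ?L (Q \<inter> H) = ennreal ((\<gamma> + x) * (\<Prod>m\<in>{1..d}-{i}. 2 * \<gamma>))" .
  have QQ: "(\<Prod>m=1..d. 2 * \<gamma>) = (2 * \<gamma>) * (\<Prod>m\<in>{1..d}-{i}. 2 * \<gamma>)"
    using i by (subst prod.remove[of _ i]) auto
  have "H \<in> sets (borel_vec d)" unfolding H_def using i by measurable
  then have "H \<in> sets ?L"
    using sets_uniform_cube[of d \<gamma>] unfolding uniform_cube_def by simp
  moreover have "emeasure ?L Q \<noteq> 0" unfolding Q using \<gamma> by simp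
  ultimately have "measure (uniform_cube d \<gamma>) H = measure ?L (Q \<inter> H) / measure ?L Q"
    unfolding uniform_cube_def Q_def[symmetric] by (intro measure_uniform_measure) (auto simp: Q simp del: One_nat_def)
  also have "\<dots> = ((\<gamma> + x) * (\<Prod>m\<in>{1..d}-{i}. 2 * \<gamma>)) / (\<Prod>m=1..d. 2 * \<gamma>)"
    using Q QH x \<gamma> by (simp add: measure_def)
  also have "\<dots> = (\<gamma> + x) / (2 * \<gamma>)"
    unfolding QQ using \<gamma> by simp
  finally show ?thesis unfolding H_def .
qed

section \<open>The sample: joint independence and unbiasedness\<close>

locale dithered_sample = prob_space P for P :: "'a measure" +
  fixes d n :: nat and \<gamma> \<eta> :: real
    and X :: "nat \<Rightarrow> 'a \<Rightarrow> nat \<Rightarrow> real" and \<Gamma> :: "nat \<times> nat \<Rightarrow> 'a \<Rightarrow> nat \<Rightarrow> real"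
  assumes sample: "iid_sample P d n X"
    and dithers: "uniform_dithers P d n \<gamma> \<Gamma>"
    and cross_indep: "dithers_independent P d n X \<Gamma>"
    and n_pos: "1 \<le> n"
    and \<eta>_pos: "0 < \<eta>"
    and \<eta>_less: "\<eta> < \<gamma>"
begin

lemma \<gamma>_pos: "0 < \<gamma>" using \<eta>_pos \<eta>_less by simp

lemma measurable_X [measurable]: "k \<in> {1..n} \<Longrightarrow> X k \<in> P \<rightarrow>\<^sub>M borel_vec d"
  using sample unfolding iid_sample_def indep_vars_def by blast

lemma measurable_\<Gamma> [measurable]: "kj \<in> {1..n} \<times> {1, 2} \<Longrightarrow> \<Gamma> kj \<in> P \<rightarrow>\<^sub>M borel_vec d"
  using dithers unfolding uniform_dithers_def indep_vars_def by blast

lemma measurable_X_component [measurable]: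
  "k \<in> {1..n} \<Longrightarrow> i \<in> {1..d} \<Longrightarrow> (\<lambda>\<omega>. X k \<omega> i) \<in> borel_measurable P"
  by (rule measurable_compose[OF measurable_X measurable_borel_vec_component])

lemma measurable_\<Gamma>_component [measurable]:
  "kj \<in> {1..n} \<times> {1, 2} \<Longrightarrow> i \<in> {1..d} \<Longrightarrow> (\<lambda>\<omega>. \<Gamma> kj \<omega> i) \<in> borel_measurable P"
  by (rule measurable_compose[OF measurable_\<Gamma> measurable_borel_vec_component])

text \<open>The sign is \<open>2 * indicator E - 1\<close>, and \<open>prob E\<close> is affine in
  \<open>x\<close> as long as \<open>\<bar>x\<bar> \<le> \<gamma>\<close>. This is why the data are
  truncated below the dithering scale.\<close>

lemma expectation_bit_sign_dither:
  assumes kj: "kj \<in> {1..n} \<times> {1, 2}" and i: "i \<in> {1..d}" and x: "\<bar>x\<bar> \<le> \<gamma>"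
  shows "expectation (\<lambda>\<omega>. bit_sign (x + \<Gamma> kj \<omega> i)) = x / \<gamma>"
proof -
  note [measurable] = measurable_\<Gamma>_component[OF kj i]
  define E where "E = {\<omega> \<in> space P. -x \<le> \<Gamma> kj \<omega> i}"
  have [measurable]: "E \<in> sets P" unfolding E_def by measurable
  have "\<Gamma> kj -` {g \<in> space (borel_vec d). -x \<le> g i} \<inter> space P = E"
    using measurable_space[OF measurable_\<Gamma>[OF kj]] by (auto simp: E_def)
  then have "prob E = measure (distr P (borel_vec d) (\<Gamma> kj)) {g \<in> space (borel_vec d). -x \<le> g i}"
    using i by (subst measure_distr) (use kj in auto)
  also have "\<dots> = (\<gamma> + x) / (2 * \<gamma>)"
  proof -
    have "distr P (borel_vec d) (\<Gamma> kj) = uniform_cube d \<gamma>"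
      using dithers kj unfolding uniform_dithers_def by blast
    then show ?thesis using measure_uniform_cube_component_ge[OF i x \<gamma>_pos] by simp
  qed
  finally have E: "prob E = (\<gamma> + x) / (2 * \<gamma>)" .
  have "expectation (\<lambda>\<omega>. bit_sign (x + \<Gamma> kj \<omega> i)) = expectation (\<lambda>\<omega>. 2 * indicator E \<omega> - 1)"
    by (intro Bochner_Integration.integral_cong)
       (auto simp: E_def bit_sign_def indicator_def)
  also have "\<dots> = 2 * prob E - 1"
    by (subst Bochner_Integration.integral_diff) (auto simp: prob_space intro!: integrable_const_bound[where B=1])
  also have "\<dots> = x / \<gamma>" using \<gamma>_pos by (simp add: E field_simps)
  finally show ?thesis .
qed

text \<open>The data and the dithers as one family: index \<open>(k, 0)\<close> carries \<open>X k\<close>.\<close>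

definition joint :: "nat \<times> nat \<Rightarrow> 'a \<Rightarrow> nat \<Rightarrow> real" where
  "joint kj = (if snd kj = 0 then X (fst kj) else \<Gamma> kj)"

lemma joint_simps [simp]:
  "joint (k, 0) = X k" "joint (k, Suc j) = \<Gamma> (k, Suc j)"
  "joint (k, 1) = \<Gamma> (k, 1)" "joint (k, 2) = \<Gamma> (k, 2)"
  by (auto simp: joint_def)

text \<open>The three independence hypotheses are merged: an intersection over all indices splits
  into a data event \<open>E1\<close> and a dither event \<open>E2\<close>; cross independence
  factors these two, and independence within each family factors the rest.\<close>

lemma indep_vars_joint: "indep_vars (\<lambda>_. borel_vec d) joint ({1..n} \<times> {0, 1, 2})"
proof -
  let ?N = "\<lambda>_. borel_vec d" and ?I = "{1..n} \<times> {0, 1, 2::nat}" and ?D = "{1..n} \<times> {1, 2::nat}"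
  let ?F = "\<lambda>kj. {joint kj -` A \<inter> space P | A. A \<in> sets (borel_vec d)}"
  have rv: "joint kj \<in> P \<rightarrow>\<^sub>M borel_vec d" if "kj \<in> ?I" for kj
    using that by (auto simp: joint_def)
  \<comment> \<open>On a finite index set it suffices to factor the full intersection: each class
    contains the whole space, which covers the smaller subfamilies.\<close>
  have "indep_sets ?F ?I"
  proof (subst indep_sets_finite)
    show "?I \<noteq> {}" using n_pos by auto
    show "finite ?I" by simp
    show "?F kj \<subseteq> events" if "kj \<in> ?I" for kj using rv[OF that] by auto
    show "space P \<in> ?F kj" if "kj \<in> ?I" for kj
      using measurable_space[OF rv[OF that]] by (auto intro!: exI[of _ "space (borel_vec d)"])
    show "\<forall>A\<in>Pi ?I ?F. prob (\<Inter>kj\<in>?I. A kj) = (\<Prod>kj\<in>?I. prob (A kj))"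
    proof
      fix A assume A: "A \<in> Pi ?I ?F"
      then have "\<forall>kj\<in>?I. \<exists>B. A kj = joint kj -` B \<inter> space P \<and> B \<in> sets (borel_vec d)" by blast
      then obtain B where B: "\<And>kj. kj \<in> ?I \<Longrightarrow> A kj = joint kj -` B kj \<inter> space P"
        "\<And>kj. kj \<in> ?I \<Longrightarrow> B kj \<in> sets (borel_vec d)" by metis
      define E1 where "E1 = (\<Inter>k\<in>{1..n}. X k -` B (k, 0) \<inter> space P)"
      define E2 where "E2 = (\<Inter>kj\<in>?D. \<Gamma> kj -` B kj \<inter> space P)"
      have A1: "A (k, 0) = X k -` B (k, 0) \<inter> space P" if "k \<in> {1..n}" for k
        using B(1)[of "(k, 0)"] that by simp
      have A2: "A kj = \<Gamma> kj -` B kj \<inter> space P" if "kj \<in> ?D" for kj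
        using B(1)[of kj] that by (auto simp: joint_def)
      have Idec: "?I = (\<lambda>k. (k, 0)) ` {1..n} \<union> ?D" by auto
      have "(\<Inter>kj\<in>?I. A kj) = (\<Inter>k\<in>{1..n}. A (k, 0)) \<inter> (\<Inter>kj\<in>?D. A kj)"
        unfolding Idec by (simp only: INT_Un image_image INT_simps)
      also have "(\<Inter>k\<in>{1..n}. A (k, 0)) = E1"
        unfolding E1_def using A1 by (intro INF_cong) auto
      also have "(\<Inter>kj\<in>?D. A kj) = E2"
        unfolding E2_def using A2 by (intro INF_cong) auto
      finally have INT: "(\<Inter>kj\<in>?I. A kj) = E1 \<inter> E2" .
      \<comment> \<open>As the preimage of a box under the whole data tuple, \<open>E1\<close> lies
        in the sigma-algebra to which cross independence refers; \<open>E2\<close> is treated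
        alike.\<close>
      have "E1 = (\<lambda>\<omega>. \<lambda>k\<in>{1..n}. X k \<omega>) -` (\<Pi>\<^sub>E k\<in>{1..n}. B (k, 0)) \<inter> space P"
        using n_pos by (auto simp: E1_def PiE_iff)
      moreover have "(\<Pi>\<^sub>E k\<in>{1..n}. B (k, 0)) \<in> sets (Pi\<^sub>M {1..n} ?N)"
        using B(2) by (intro sets_PiM_I_finite) auto
      ultimately have E1: "E1 \<in> sets (vimage_algebra (space P) (\<lambda>\<omega>. \<lambda>k\<in>{1..n}. X k \<omega>) (Pi\<^sub>M {1..n} ?N))"
        using in_vimage_algebra by blast
      have "E2 = (\<lambda>\<omega>. \<lambda>kj\<in>?D. \<Gamma> kj \<omega>) -` (\<Pi>\<^sub>E kj\<in>?D. B kj) \<inter> space P"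
        using n_pos by (auto simp: E2_def PiE_iff)
      moreover have "(\<Pi>\<^sub>E kj\<in>?D. B kj) \<in> sets (Pi\<^sub>M ?D ?N)"
        using B(2) by (intro sets_PiM_I_finite) auto
      ultimately have E2: "E2 \<in> sets (vimage_algebra (space P) (\<lambda>\<omega>. \<lambda>kj\<in>?D. \<Gamma> kj \<omega>) (Pi\<^sub>M ?D ?N))"
        using in_vimage_algebra by blast
      have P1: "prob E1 = (\<Prod>k\<in>{1..n}. prob (A (k, 0)))"
      proof -
        have "indep_vars ?N X {1..n}" using sample by (simp add: iid_sample_def)
        then have "prob E1 = (\<Prod>k\<in>{1..n}. prob (X k -` B (k, 0) \<inter> space P))"
          unfolding E1_def using n_pos B(2) by (intro indep_varsD_finite[where M'="?N"]) auto
        then show ?thesis using A1 by simp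
      qed
      have P2: "prob E2 = (\<Prod>kj\<in>?D. prob (A kj))"
      proof -
        have "indep_vars ?N \<Gamma> ?D" using dithers by (simp add: uniform_dithers_def)
        then have "prob E2 = (\<Prod>kj\<in>?D. prob (\<Gamma> kj -` B kj \<inter> space P))"
          unfolding E2_def using n_pos B(2) by (intro indep_varsD_finite[where M'="?N"]) auto
        then show ?thesis using A2 by simp
      qed
      have "prob (E1 \<inter> E2) = prob E1 * prob E2"
        using cross_indep E1 E2 unfolding dithers_independent_def by (intro indep_setD)
      also have "\<dots> = (\<Prod>kj\<in>?I. prob (A kj))"
        unfolding P1 P2 Idec
        by (subst prod.union_disjoint) (auto simp: prod.reindex inj_on_def)
      finally show "prob (\<Inter>kj\<in>?I. A kj) = (\<Prod>kj\<in>?I. prob (A kj))" unfolding INT .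
    qed
  qed
  then show ?thesis unfolding indep_vars_def2 using rv by auto
qed

definition summand :: "nat \<Rightarrow> nat \<Rightarrow> nat \<Rightarrow> 'a \<Rightarrow> real" where
  "summand i j k \<omega> = \<gamma>\<^sup>2 / 2 *
     (one_bit \<eta> (X k \<omega>) (\<Gamma> (k, 1) \<omega>) i * one_bit \<eta> (X k \<omega>) (\<Gamma> (k, 2) \<omega>) j
      + one_bit \<eta> (X k \<omega>) (\<Gamma> (k, 2) \<omega>) i * one_bit \<eta> (X k \<omega>) (\<Gamma> (k, 1) \<omega>) j)"

lemma raw_estimator_eq_mean:
  "raw_estimator \<eta> \<gamma> n (\<lambda>k. X k \<omega>) (\<lambda>kj. \<Gamma> kj \<omega>) i j = (\<Sum>k=1..n. summand i j k \<omega>) / n"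
  by (simp add: raw_estimator_def summand_def sum_distrib_left sum_divide_distrib)

lemma abs_summand_le: "\<bar>summand i j k \<omega>\<bar> \<le> \<gamma>\<^sup>2"
proof -
  have "\<bar>summand i j k \<omega>\<bar> \<le> \<gamma>\<^sup>2 / 2 *
     (\<bar>one_bit \<eta> (X k \<omega>) (\<Gamma> (k, 1) \<omega>) i * one_bit \<eta> (X k \<omega>) (\<Gamma> (k, 2) \<omega>) j\<bar>
      + \<bar>one_bit \<eta> (X k \<omega>) (\<Gamma> (k, 2) \<omega>) i * one_bit \<eta> (X k \<omega>) (\<Gamma> (k, 1) \<omega>) j\<bar>)"
    unfolding summand_def by (subst abs_mult) (intro mult_mono abs_triangle_ineq, auto)
  then show ?thesis by (simp add: abs_mult)
qed

lemma measurable_one_bit: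
  assumes "k \<in> {1..n}" "l \<in> {1, 2}" "i \<in> {1..d}"
  shows "(\<lambda>\<omega>. one_bit \<eta> (X k \<omega>) (\<Gamma> (k, l) \<omega>) i) \<in> borel_measurable P"
proof -
  have "(k, l) \<in> {1..n} \<times> {1, 2}" using assms by simp
  note [measurable] = measurable_\<Gamma>_component[OF this assms(3)] measurable_X_component[OF assms(1,3)]
  show ?thesis unfolding one_bit_def by measurable
qed

text \<open>Each summand reads only the block \<open>{k} \<times> {0, 1, 2}\<close> of
  \<open>joint\<close>, and the blocks of different \<open>k\<close> are disjoint.\<close>

lemma indep_vars_summand:
  assumes [measurable]: "i \<in> {1..d}" "j \<in> {1..d}"
  shows "indep_vars (\<lambda>_. borel) (summand i j) {1..n}"
proof -
  define f where "f = (\<lambda>(k::nat) (z :: nat \<times> nat \<Rightarrow> nat \<Rightarrow> real). \<gamma>\<^sup>2 / 2 *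
     (one_bit \<eta> (z (k, 0)) (z (k, 1)) i * one_bit \<eta> (z (k, 0)) (z (k, 2)) j
      + one_bit \<eta> (z (k, 0)) (z (k, 2)) i * one_bit \<eta> (z (k, 0)) (z (k, 1)) j))"
  define J where "J = (\<lambda>k::nat. {k} \<times> {0, 1, 2::nat})"
  have "indep_vars (\<lambda>k. Pi\<^sub>M (J k) (\<lambda>_. borel_vec d)) (\<lambda>k \<omega>. restrict (\<lambda>kj. joint kj \<omega>) (J k)) {1..n}"
    by (rule indep_vars_restrict[OF indep_vars_joint])
       (auto simp: J_def disjoint_family_on_def)
  then have "indep_vars (\<lambda>_. borel) (\<lambda>k \<omega>. f k (restrict (\<lambda>kj. joint kj \<omega>) (J k))) {1..n}"
  proof (rule indep_vars_compose2)
    fix k assume "k \<in> {1..n}"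
    have c: "(\<lambda>z. z (k, l) m) \<in> borel_measurable (Pi\<^sub>M (J k) (\<lambda>_. borel_vec d))"
      if "l \<in> {0, 1, 2}" "m \<in> {1..d}" for l m
      using that by (intro measurable_PiM_borel_vec_component) (auto simp: J_def)
    have [measurable]: "(\<lambda>z. z (k, 0) i) \<in> borel_measurable (Pi\<^sub>M (J k) (\<lambda>_. borel_vec d))"
      "(\<lambda>z. z (k, 1) i) \<in> borel_measurable (Pi\<^sub>M (J k) (\<lambda>_. borel_vec d))"
      "(\<lambda>z. z (k, 2) i) \<in> borel_measurable (Pi\<^sub>M (J k) (\<lambda>_. borel_vec d))"
      "(\<lambda>z. z (k, 0) j) \<in> borel_measurable (Pi\<^sub>M (J k) (\<lambda>_. borel_vec d))"
      "(\<lambda>z. z (k, 1) j) \<in> borel_measurable (Pi\<^sub>M (J k) (\<lambda>_. borel_vec d))"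
      "(\<lambda>z. z (k, 2) j) \<in> borel_measurable (Pi\<^sub>M (J k) (\<lambda>_. borel_vec d))"
      using assms by (auto intro!: c)
    show "f k \<in> borel_measurable (Pi\<^sub>M (J k) (\<lambda>_. borel_vec d))"
      unfolding f_def one_bit_def by measurable
  qed
  then show ?thesis
    by (subst (asm) indep_vars_cong[OF refl, where Y="summand i j"])
       (auto simp: f_def J_def summand_def)
qed

text \<open>Fubini with the data \<open>U\<close> held fixed: the two dithers are independent of
  \<open>U\<close> and of each other, so the inner integral is a product of two unbiased means. With
  distinct dithers this covers the diagonal \<open>i = j\<close>, where a shared dither would give
  the constant 1.\<close>

lemma expectation_one_bit_mult:
  assumes k: "k \<in> {1..n}" and i: "i \<in> {1..d}" and j: "j \<in> {1..d}"
    and lm: "(l, m) = (1, 2) \<or> (l, m) = (2, 1)"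
  shows "expectation (\<lambda>\<omega>. one_bit \<eta> (X k \<omega>) (\<Gamma> (k, l) \<omega>) i * one_bit \<eta> (X k \<omega>) (\<Gamma> (k, m) \<omega>) j)
    = expectation (\<lambda>\<omega>. truncate_at \<eta> (X k \<omega> i) * truncate_at \<eta> (X k \<omega> j)) / \<gamma>\<^sup>2"
proof -
  let ?N = "\<lambda>_. borel_vec d"
  define S where "S = Pi\<^sub>M {(k, 0::nat)} ?N"
  define T where "T = Pi\<^sub>M {(k, l), (k, m)} ?N"
  define U where "U = (\<lambda>\<omega>. restrict (\<lambda>kj. joint kj \<omega>) {(k, 0)})"
  define V where "V = (\<lambda>\<omega>. restrict (\<lambda>kj. joint kj \<omega>) {(k, l), (k, m)})"
  define f where "f = (\<lambda>(x :: nat \<times> nat \<Rightarrow> nat \<Rightarrow> real) g. bit_sign (truncate_at \<eta> (x (k, 0) i) + g (k, l) i)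
    * bit_sign (truncate_at \<eta> (x (k, 0) j) + g (k, m) j))"
  have lD: "(k, l) \<in> {1..n} \<times> {1, 2}" and mD: "(k, m) \<in> {1..n} \<times> {1, 2}"
    using k lm by auto
  have U: "U \<omega> (k, 0) = X k \<omega>" for \<omega> by (simp add: U_def)
  have V: "V \<omega> (k, l) = \<Gamma> (k, l) \<omega>" "V \<omega> (k, m) = \<Gamma> (k, m) \<omega>" for \<omega>
    using lm by (auto simp: V_def joint_def)
  have S [measurable]: "(\<lambda>x. x (k, 0) i) \<in> borel_measurable S" "(\<lambda>x. x (k, 0) j) \<in> borel_measurable S"
    unfolding S_def using i j by (auto intro!: measurable_PiM_borel_vec_component)
  have T [measurable]: "(\<lambda>x. x (k, l) i) \<in> borel_measurable T" "(\<lambda>x. x (k, m) j) \<in> borel_measurable T"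
    unfolding T_def using i j by (auto intro!: measurable_PiM_borel_vec_component)
  have UV: "indep_var S U T V"
    unfolding S_def T_def U_def V_def using k lm by (intro indep_var_restrict[OF indep_vars_joint]) auto
  note [measurable] = indep_var_rv1[OF UV] indep_var_rv2[OF UV]
    measurable_\<Gamma>_component[OF lD i] measurable_\<Gamma>_component[OF mD j]
    measurable_X_component[OF k i] measurable_X_component[OF k j]
  have fm [measurable]: "case_prod f \<in> borel_measurable (S \<Otimes>\<^sub>M T)"
    unfolding f_def case_prod_beta by measurable
  have f1: "norm (f x g) \<le> 1" for x g by (simp add: f_def abs_mult)
  have dither_indep: "indep_var borel (\<lambda>\<omega>. bit_sign (a + \<Gamma> (k, l) \<omega> i)) borel (\<lambda>\<omega>. bit_sign (b + \<Gamma> (k, m) \<omega> j))"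
    for a b
  proof -
    have "indep_var (Pi\<^sub>M {(k, l)} ?N) (\<lambda>\<omega>. restrict (\<lambda>kj. joint kj \<omega>) {(k, l)})
            (Pi\<^sub>M {(k, m)} ?N) (\<lambda>\<omega>. restrict (\<lambda>kj. joint kj \<omega>) {(k, m)})"
      using k lm by (intro indep_var_restrict[OF indep_vars_joint]) auto
    moreover have [measurable]: "(\<lambda>z. z (k, l) i) \<in> borel_measurable (Pi\<^sub>M {(k, l)} ?N)"
      "(\<lambda>z. z (k, m) j) \<in> borel_measurable (Pi\<^sub>M {(k, m)} ?N)"
      using i j by (auto intro!: measurable_PiM_borel_vec_component)
    have "(\<lambda>z. bit_sign (a + z (k, l) i)) \<in> borel_measurable (Pi\<^sub>M {(k, l)} ?N)"
      "(\<lambda>z. bit_sign (b + z (k, m) j)) \<in> borel_measurable (Pi\<^sub>M {(k, m)} ?N)"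
      by measurable
    ultimately have "indep_var
        borel ((\<lambda>z. bit_sign (a + z (k, l) i)) \<circ> (\<lambda>\<omega>. restrict (\<lambda>kj. joint kj \<omega>) {(k, l)}))
        borel ((\<lambda>z. bit_sign (b + z (k, m) j)) \<circ> (\<lambda>\<omega>. restrict (\<lambda>kj. joint kj \<omega>) {(k, m)}))"
      by (rule indep_var_compose)
    then show ?thesis using lm by (auto simp: comp_def joint_def)
  qed
  have inner: "(\<integral>g. f x g \<partial>distr P T V)
      = truncate_at \<eta> (x (k, 0) i) / \<gamma> * (truncate_at \<eta> (x (k, 0) j) / \<gamma>)" for x
  proof -
    define a b where "a = truncate_at \<eta> (x (k, 0) i)" and "b = truncate_at \<eta> (x (k, 0) j)"
    have ab: "\<bar>a\<bar> \<le> \<gamma>" "\<bar>b\<bar> \<le> \<gamma>"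
      using abs_truncate_at_le[of \<eta>] \<eta>_pos \<eta>_less unfolding a_def b_def by (meson less_imp_le order.trans)+
    have [measurable]: "f x \<in> borel_measurable T" unfolding f_def by measurable
    have "(\<integral>g. f x g \<partial>distr P T V) = expectation (\<lambda>\<omega>. bit_sign (a + \<Gamma> (k, l) \<omega> i) * bit_sign (b + \<Gamma> (k, m) \<omega> j))"
      by (subst integral_distr) (simp_all add: f_def a_def b_def V)
    also have "\<dots> = expectation (\<lambda>\<omega>. bit_sign (a + \<Gamma> (k, l) \<omega> i)) * expectation (\<lambda>\<omega>. bit_sign (b + \<Gamma> (k, m) \<omega> j))"
      by (rule indep_var_lebesgue_integral[OF dither_indep]; rule integrable_const_bound[where B=1]) simp_all
    also have "\<dots> = a / \<gamma> * (b / \<gamma>)"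
      using expectation_bit_sign_dither[OF lD i ab(1)] expectation_bit_sign_dither[OF mD j ab(2)] by simp
    finally show ?thesis unfolding a_def b_def .
  qed
  have joint_distr: "distr P S U \<Otimes>\<^sub>M distr P T V = distr P (S \<Otimes>\<^sub>M T) (\<lambda>\<omega>. (U \<omega>, V \<omega>))"
    using UV by (simp add: indep_var_distribution_eq)
  interpret D1: prob_space "distr P S U" by (rule prob_space_distr) measurable
  interpret D2: prob_space "distr P T V" by (rule prob_space_distr) measurable
  interpret D: pair_prob_space "distr P S U" "distr P T V" ..
  have int: "integrable (distr P S U \<Otimes>\<^sub>M distr P T V) (case_prod f)"
  proof (rule D.integrable_const_bound[where B=1])
    show "case_prod f \<in> borel_measurable (distr P S U \<Otimes>\<^sub>M distr P T V)"
      unfolding joint_distr by simp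
  qed (use f1 in auto)
  have "expectation (\<lambda>\<omega>. one_bit \<eta> (X k \<omega>) (\<Gamma> (k, l) \<omega>) i * one_bit \<eta> (X k \<omega>) (\<Gamma> (k, m) \<omega>) j)
     = (\<integral>z. case_prod f z \<partial>distr P (S \<Otimes>\<^sub>M T) (\<lambda>\<omega>. (U \<omega>, V \<omega>)))"
    by (subst integral_distr) (simp_all add: f_def one_bit_def U V)
  also have "\<dots> = (\<integral>z. case_prod f z \<partial>(distr P S U \<Otimes>\<^sub>M distr P T V))"
    by (simp only: joint_distr)
  also have "\<dots> = (\<integral>x. (\<integral>g. f x g \<partial>distr P T V) \<partial>distr P S U)"
    using D.integral_fst'[OF int] by simp
  also have "\<dots> = (\<integral>x. truncate_at \<eta> (x (k, 0) i) / \<gamma> * (truncate_at \<eta> (x (k, 0) j) / \<gamma>) \<partial>distr P S U)"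
    by (simp only: inner)
  also have "\<dots> = expectation (\<lambda>\<omega>. truncate_at \<eta> (X k \<omega> i) / \<gamma> * (truncate_at \<eta> (X k \<omega> j) / \<gamma>))"
    by (subst integral_distr) (simp_all add: U)
  also have "\<dots> = expectation (\<lambda>\<omega>. truncate_at \<eta> (X k \<omega> i) * truncate_at \<eta> (X k \<omega> j)) / \<gamma>\<^sup>2"
    by (simp add: power2_eq_square)
  finally show ?thesis .
qed

end

section \<open>Concentration\<close>

text \<open>Independence factors the exponential of the sum, and Hoeffding's lemma bounds each
  factor.\<close>

lemma (in prob_space) nn_integral_exp_centered_sum_le:
  fixes Y :: "'i \<Rightarrow> 'a \<Rightarrow> real" and l B :: real
  assumes fin: "finite I" and indep: "indep_vars (\<lambda>_. borel) Y I"
    and bound: "\<And>i \<omega>. i \<in> I \<Longrightarrow> \<bar>Y i \<omega>\<bar> \<le> B" and l: "0 < l"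
  shows "(\<integral>\<^sup>+\<omega>. exp (l * (\<Sum>i\<in>I. Y i \<omega> - expectation (Y i))) \<partial>M)
    \<le> ennreal (exp (card I * l\<^sup>2 * B\<^sup>2 / 2))"
proof -
  have "(\<integral>\<^sup>+\<omega>. exp (l * (\<Sum>i\<in>I. Y i \<omega> - expectation (Y i))) \<partial>M)
      = (\<integral>\<^sup>+\<omega>. (\<Prod>i\<in>I. ennreal (exp (l * (Y i \<omega> - expectation (Y i))))) \<partial>M)"
    using fin by (simp add: prod_ennreal sum_distrib_left exp_sum)
  also have "\<dots> = (\<Prod>i\<in>I. \<integral>\<^sup>+\<omega>. ennreal (exp (l * (Y i \<omega> - expectation (Y i)))) \<partial>M)"
  proof (rule indep_vars_nn_integral[OF fin])
    show "indep_vars (\<lambda>_. borel) (\<lambda>i \<omega>. ennreal (exp (l * (Y i \<omega> - expectation (Y i))))) I"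
      using indep by (rule indep_vars_compose2) measurable
  qed simp
  also have "\<dots> \<le> (\<Prod>i\<in>I. ennreal (exp (l\<^sup>2 * B\<^sup>2 / 2)))"
  proof (rule prod_mono_ennreal)
    fix i assume i: "i \<in> I"
    interpret interval_bounded_random_variable M "Y i" "-B" B
    proof
      show "random_variable borel (Y i)" using indep i unfolding indep_vars_def by blast
      show "AE x in M. Y i x \<in> {- B..B}"
      proof (rule AE_I2)
        show "Y i x \<in> {- B..B}" for x using bound[OF i, of x] by auto
      qed
    qed
    \<comment> \<open>The interval has length \<open>2 * B\<close>, which turns Hoeffding's
      \<open>1 / 8\<close> into \<open>1 / 2\<close>.\<close>
    have "l\<^sup>2 * (B - - B)\<^sup>2 / 8 = l\<^sup>2 * B\<^sup>2 / 2" by (simp add: power2_eq_square)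
    then show "(\<integral>\<^sup>+\<omega>. ennreal (exp (l * (Y i \<omega> - expectation (Y i)))) \<partial>M)
        \<le> ennreal (exp (l\<^sup>2 * B\<^sup>2 / 2))"
      using Hoeffdings_lemma_nn_integral[OF l] by (simp only:)
  qed
  also have "\<dots> = ennreal (exp (card I * l\<^sup>2 * B\<^sup>2 / 2))"
    by (simp add: ennreal_power mult.assoc flip: exp_of_nat_mult)
  finally show ?thesis .
qed

text \<open>The exponential of an absolute value is at most the sum of the exponentials of both
  signs; the one-sided bound applied to \<open>- Y\<close> handles the second, whence the factor
  2.\<close>

lemma (in prob_space) nn_integral_exp_abs_centered_sum_le:
  fixes Y :: "'i \<Rightarrow> 'a \<Rightarrow> real" and l B :: real
  assumes fin: "finite I" and indep: "indep_vars (\<lambda>_. borel) Y I"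
    and bound: "\<And>i \<omega>. i \<in> I \<Longrightarrow> \<bar>Y i \<omega>\<bar> \<le> B" and l: "0 < l"
  shows "(\<integral>\<^sup>+\<omega>. exp (l * \<bar>\<Sum>i\<in>I. Y i \<omega> - expectation (Y i)\<bar>) \<partial>M)
    \<le> ennreal (2 * exp (card I * l\<^sup>2 * B\<^sup>2 / 2))"
proof -
  let ?S = "\<lambda>\<omega>. \<Sum>i\<in>I. Y i \<omega> - expectation (Y i)"
  let ?c = "exp (card I * l\<^sup>2 * B\<^sup>2 / 2)"
  have [measurable]: "Y i \<in> borel_measurable M" if "i \<in> I" for i
    using indep that unfolding indep_vars_def by blast
  have S [measurable]: "?S \<in> borel_measurable M" by measurable
  have "indep_vars (\<lambda>_. borel) (\<lambda>i \<omega>. - Y i \<omega>) I"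
    using indep by (rule indep_vars_compose2) measurable
  then have "(\<integral>\<^sup>+\<omega>. exp (l * (\<Sum>i\<in>I. - Y i \<omega> - expectation (\<lambda>\<omega>. - Y i \<omega>))) \<partial>M) \<le> ennreal ?c"
    using bound l by (intro nn_integral_exp_centered_sum_le[OF fin]) auto
  moreover have "(\<Sum>i\<in>I. - Y i \<omega> - expectation (\<lambda>\<omega>. - Y i \<omega>)) = - ?S \<omega>" for \<omega>
    by (simp add: sum_subtractf sum_negf)
  ultimately have neg: "(\<integral>\<^sup>+\<omega>. exp (l * - ?S \<omega>) \<partial>M) \<le> ennreal ?c" by (simp only:)
  have "(\<integral>\<^sup>+\<omega>. exp (l * \<bar>?S \<omega>\<bar>) \<partial>M) \<le> (\<integral>\<^sup>+\<omega>. ennreal (exp (l * ?S \<omega>)) + ennreal (exp (l * - ?S \<omega>)) \<partial>M)"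
    by (intro nn_integral_mono) (auto simp: abs_if simp flip: ennreal_plus)
  also have "\<dots> = (\<integral>\<^sup>+\<omega>. exp (l * ?S \<omega>) \<partial>M) + (\<integral>\<^sup>+\<omega>. exp (l * - ?S \<omega>) \<partial>M)"
    by (rule nn_integral_add) measurable
  also have "\<dots> \<le> ennreal ?c + ennreal ?c"
    by (intro add_mono neg nn_integral_exp_centered_sum_le[OF fin indep bound l])
  also have "\<dots> = ennreal (2 * ?c)" by (simp flip: ennreal_plus)
  finally show ?thesis .
qed

section \<open>Variables with finitely many values, and means of the summands\<close>

text \<open>A finite tuple of simple functions is simple, so an arbitrary \<open>F\<close> may be
  applied to it, here the operator norm of the error as a function of all entries. The induction
  appends a coordinate by function update.\<close>

lemma simple_function_restrict_compose:
  assumes "finite I" and "\<And>i. i \<in> I \<Longrightarrow> simple_function M (f i)"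
  shows "simple_function M (\<lambda>x. F (\<lambda>i\<in>I. f i x))"
proof -
  have "simple_function M (\<lambda>x. \<lambda>i\<in>I. f i x)"
    using assms
  proof (induction I rule: finite_induct)
    case empty
    then show ?case by simp
  next
    case (insert i I)
    have "simple_function M (\<lambda>x. (\<lambda>(g, y). g(i := y)) ((\<lambda>i\<in>I. f i x), f i x))"
      using insert by (intro simple_function_compose1[OF simple_function_Pair]) auto
    moreover have "(\<lambda>(g, y). g(i := y)) ((\<lambda>i\<in>I. f i x), f i x) = (\<lambda>i\<in>insert i I. f i x)" for x
      by auto
    ultimately show ?case by (simp only:)
  qed
  then show ?thesis by (rule simple_function_compose1)
qed

lemma (in finite_measure) integrable_simple_function_real:
  fixes f :: "'a \<Rightarrow> real"
  assumes "simple_function M f"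
  shows "integrable M f"
proof (rule integrable_const_bound)
  have "finite (f ` space M)" using assms by (rule simple_functionD)
  then show "AE x in M. norm (f x) \<le> Max ((\<lambda>y. \<bar>y\<bar>) ` f ` space M)"
    by (intro AE_I2) (auto intro!: Max_ge)
qed (rule borel_measurable_simple_function[OF assms])

context dithered_sample
begin

lemma simple_function_one_bit:
  assumes "k \<in> {1..n}" "l \<in> {1, 2}" "i \<in> {1..d}"
  shows "simple_function P (\<lambda>\<omega>. one_bit \<eta> (X k \<omega>) (\<Gamma> (k, l) \<omega>) i)"
proof (rule simple_function_borel_measurable[OF measurable_one_bit[OF assms]])
  have "(\<lambda>\<omega>. one_bit \<eta> (X k \<omega>) (\<Gamma> (k, l) \<omega>) i) ` space P \<subseteq> {1, -1}"
    by (auto simp: one_bit_def bit_sign_def)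
  then show "finite ((\<lambda>\<omega>. one_bit \<eta> (X k \<omega>) (\<Gamma> (k, l) \<omega>) i) ` space P)"
    by (rule finite_subset) simp
qed

lemma simple_function_raw_estimator:
  assumes i: "i \<in> {1..d}" and j: "j \<in> {1..d}"
  shows "simple_function P (\<lambda>\<omega>. raw_estimator \<eta> \<gamma> n (\<lambda>k. X k \<omega>) (\<lambda>kj. \<Gamma> kj \<omega>) i j)"
  unfolding raw_estimator_def
  by (intro simple_function_mult simple_function_const simple_function_sum simple_function_add
      simple_function_one_bit i j) auto

text \<open>
  The bits take finitely many values, so the measurability of the supremum in \<open>op_norm\<close> is not
  an issue, and neither is integrability.
\<close>

lemma simple_function_op_norm_cov_estimator:
  "simple_function P (\<lambda>\<omega>. op_norm d
     (\<lambda>i j. cov_estimator \<eta> \<gamma> \<zeta> n (\<lambda>k. X k \<omega>) (\<lambda>kj. \<Gamma> kj \<omega>) i j - S i j))"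
proof -
  let ?R = "\<lambda>\<omega> i j. raw_estimator \<eta> \<gamma> n (\<lambda>k. X k \<omega>) (\<lambda>kj. \<Gamma> kj \<omega>) i j"
  have "simple_function P (\<lambda>\<omega>. (\<lambda>r. op_norm d (\<lambda>i j. hard_threshold \<zeta> (r (i, j)) - S i j))
      (\<lambda>ij\<in>{1..d}\<times>{1..d}. ?R \<omega> (fst ij) (snd ij)))"
    by (rule simple_function_restrict_compose) (auto intro!: simple_function_raw_estimator)
  moreover have "op_norm d (\<lambda>i j. hard_threshold \<zeta> ((\<lambda>ij\<in>{1..d}\<times>{1..d}. ?R \<omega> (fst ij) (snd ij)) (i, j)) - S i j)
      = op_norm d (\<lambda>i j. cov_estimator \<eta> \<gamma> \<zeta> n (\<lambda>k. X k \<omega>) (\<lambda>kj. \<Gamma> kj \<omega>) i j - S i j)" for \<omega>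
    by (rule op_norm_cong) (simp add: cov_estimator_def)
  ultimately show ?thesis by simp
qed

text \<open>Both orders of the dithers have the same mean, and the factor
  \<open>\<gamma>\<^sup>2 / 2\<close> undoes the scaling of the two signs.\<close>

lemma expectation_summand:
  assumes k: "k \<in> {1..n}" and i: "i \<in> {1..d}" and j: "j \<in> {1..d}"
  shows "expectation (summand i j k) = expectation (\<lambda>\<omega>. truncate_at \<eta> (X k \<omega> i) * truncate_at \<eta> (X k \<omega> j))"
proof -
  let ?b = "\<lambda>l m \<omega>. one_bit \<eta> (X k \<omega>) (\<Gamma> (k, l) \<omega>) i * one_bit \<eta> (X k \<omega>) (\<Gamma> (k, m) \<omega>) j"
  have int: "integrable P (?b l m)" if "l \<in> {1, 2}" "m \<in> {1, 2}" for l m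
    using that k i j
    by (intro integrable_simple_function_real simple_function_mult simple_function_one_bit)
  have "expectation (summand i j k) = \<gamma>\<^sup>2 / 2 * (expectation (?b 1 2) + expectation (?b 2 1))"
    unfolding summand_def using int[of 1 2] int[of 2 1] by (subst integral_mult_right_zero, subst Bochner_Integration.integral_add) auto
  also have "expectation (?b 1 2) = expectation (\<lambda>\<omega>. truncate_at \<eta> (X k \<omega> i) * truncate_at \<eta> (X k \<omega> j)) / \<gamma>\<^sup>2"
    by (rule expectation_one_bit_mult[OF k i j]) simp
  also have "expectation (?b 2 1) = expectation (\<lambda>\<omega>. truncate_at \<eta> (X k \<omega> i) * truncate_at \<eta> (X k \<omega> j)) / \<gamma>\<^sup>2"
    by (rule expectation_one_bit_mult[OF k i j]) simp
  finally show ?thesis using \<gamma>_pos by (simp add: field_simps)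
qed

lemma centered_cov_sample:
  assumes k: "k \<in> {1..n}" and i: "i \<in> {1..d}" and j: "j \<in> {1..d}"
  shows "centered_cov P (X 1) i j = expectation (\<lambda>\<omega>. X k \<omega> i * X k \<omega> j)"
proof -
  have 1: "(1::nat) \<in> {1..n}" using n_pos by simp
  have f [measurable]: "(\<lambda>x. x i * x j) \<in> borel_measurable (borel_vec d)" using i j by measurable
  have eq: "distr P (borel_vec d) (X k) = distr P (borel_vec d) (X 1)"
    using sample k unfolding iid_sample_def by blast
  have "expectation (\<lambda>\<omega>. X k \<omega> i * X k \<omega> j) = (\<integral>x. x i * x j \<partial>distr P (borel_vec d) (X k))"
    by (rule integral_distr[OF measurable_X[OF k] f, symmetric])
  also have "\<dots> = expectation (\<lambda>\<omega>. X 1 \<omega> i * X 1 \<omega> j)"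
    unfolding eq by (rule integral_distr[OF measurable_X[OF 1] f])
  finally show ?thesis by (simp add: centered_cov_def)
qed

end

section \<open>Truncation bias and exponential moments of the entrywise error\<close>

locale bounded_fourth_moment_sample = dithered_sample +
  fixes M :: real
  assumes moment: "\<And>k i. k \<in> {1..n} \<Longrightarrow> i \<in> {1..d} \<Longrightarrow>
    integrable P (\<lambda>\<omega>. \<bar>X k \<omega> i\<bar> ^ 4) \<and> (\<integral>\<omega>. \<bar>X k \<omega> i\<bar> ^ 4 \<partial>P) \<le> M"
begin

text \<open>The pointwise truncation loss is integrated; each of the two coordinates contributes
  \<open>M / \<eta>\<^sup>2\<close>.\<close>

lemma abs_expectation_summand_minus_cov_le:
  assumes k: "k \<in> {1..n}" and i: "i \<in> {1..d}" and j: "j \<in> {1..d}"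
  shows "\<bar>expectation (summand i j k) - centered_cov P (X 1) i j\<bar> \<le> 2 * M / \<eta>\<^sup>2"
proof -
  note [measurable] = measurable_X_component[OF k i] measurable_X_component[OF k j]
  let ?x = "\<lambda>\<omega>. X k \<omega> i" and ?y = "\<lambda>\<omega>. X k \<omega> j"
  let ?t = "\<lambda>\<omega>. truncate_at \<eta> (?x \<omega>) * truncate_at \<eta> (?y \<omega>)"
  let ?e = "\<lambda>\<omega>. (\<bar>?x \<omega>\<bar> ^ 4 + \<bar>?y \<omega>\<bar> ^ 4) / \<eta>\<^sup>2"
  have e: "integrable P ?e" using moment[OF k i] moment[OF k j] by simp
  have t: "integrable P ?t"
    using abs_truncate_at_le[of \<eta>] \<eta>_pos
    by (intro integrable_const_bound[where B="\<eta> * \<eta>"] AE_I2) (auto simp: abs_mult intro!: mult_mono)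
  have diff: "\<bar>?x \<omega> * ?y \<omega> - ?t \<omega>\<bar> \<le> ?e \<omega>" for \<omega>
    by (rule abs_mult_diff_truncate_at_le[OF \<eta>_pos])
  \<comment> \<open>Integrability of the product itself is recovered from the loss, dominated by
    fourth powers, plus the bounded truncated product.\<close>
  have xyt: "integrable P (\<lambda>\<omega>. ?x \<omega> * ?y \<omega> - ?t \<omega>)"
    by (rule Bochner_Integration.integrable_bound[OF e]) (use diff in \<open>auto intro!: order.trans[OF diff]\<close>)
  have "integrable P (\<lambda>\<omega>. (?x \<omega> * ?y \<omega> - ?t \<omega>) + ?t \<omega>)"
    using xyt t by (rule Bochner_Integration.integrable_add)
  then have xy: "integrable P (\<lambda>\<omega>. ?x \<omega> * ?y \<omega>)" by simp
  have "\<bar>expectation (summand i j k) - centered_cov P (X 1) i j\<bar>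
      = \<bar>expectation (\<lambda>\<omega>. ?x \<omega> * ?y \<omega> - ?t \<omega>)\<bar>"
    unfolding expectation_summand[OF k i j] centered_cov_sample[OF k i j]
    by (subst Bochner_Integration.integral_diff[OF xy t]) (rule abs_minus_commute)
  also have "\<dots> \<le> expectation ?e"
    by (rule order.trans[OF integral_abs_bound integral_mono[OF integrable_abs[OF xyt] e diff]])
  also have "\<dots> \<le> (M + M) / \<eta>\<^sup>2"
    using moment[OF k i] moment[OF k j] by (simp add: add_mono divide_right_mono)
  finally show ?thesis by simp
qed

text \<open>The error is a centred mean plus a bias. Hoeffding at rate \<open>l / n\<close> for
  \<open>n\<close> variables bounded by \<open>\<gamma>\<^sup>2\<close> yields the term quadratic in
  \<open>l\<close>, and the bias yields the linear one.\<close>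

lemma expectation_exp_raw_estimator_error_le:
  assumes i: "i \<in> {1..d}" and j: "j \<in> {1..d}" and l: "0 < l"
  shows "expectation (\<lambda>\<omega>. exp (l * \<bar>raw_estimator \<eta> \<gamma> n (\<lambda>k. X k \<omega>) (\<lambda>kj. \<Gamma> kj \<omega>) i j
      - centered_cov P (X 1) i j\<bar>)) \<le> 2 * exp (l\<^sup>2 * \<gamma> ^ 4 / (2 * n) + l * (2 * M / \<eta>\<^sup>2))"
proof -
  let ?R = "\<lambda>\<omega>. raw_estimator \<eta> \<gamma> n (\<lambda>k. X k \<omega>) (\<lambda>kj. \<Gamma> kj \<omega>) i j"
  let ?S = "centered_cov P (X 1) i j"
  let ?D = "\<lambda>\<omega>. \<Sum>k=1..n. summand i j k \<omega> - expectation (summand i j k)"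
  have n: "0 < real n" using n_pos by simp
  have le: "l * \<bar>?R \<omega> - ?S\<bar> \<le> (l / n) * \<bar>?D \<omega>\<bar> + l * (2 * M / \<eta>\<^sup>2)" for \<omega>
  proof -
    have "\<bar>\<Sum>k=1..n. expectation (summand i j k) - ?S\<bar> \<le> (\<Sum>k=1..n. 2 * M / \<eta>\<^sup>2)"
      by (rule order.trans[OF sum_abs]) (intro sum_mono abs_expectation_summand_minus_cov_le i j)
    then have B: "\<bar>\<Sum>k=1..n. expectation (summand i j k) - ?S\<bar> \<le> n * (2 * M / \<eta>\<^sup>2)" by simp
    have "n * (?R \<omega> - ?S) = ?D \<omega> + (\<Sum>k=1..n. expectation (summand i j k) - ?S)"
      using n by (simp add: raw_estimator_eq_mean sum_subtractf field_simps)
    then have "n * \<bar>?R \<omega> - ?S\<bar> = \<bar>?D \<omega> + (\<Sum>k=1..n. expectation (summand i j k) - ?S)\<bar>"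
      using n by (metis abs_mult abs_of_pos)
    also have "\<dots> \<le> \<bar>?D \<omega>\<bar> + n * (2 * M / \<eta>\<^sup>2)"
      using B by linarith
    finally have "\<bar>?R \<omega> - ?S\<bar> \<le> \<bar>?D \<omega>\<bar> / n + 2 * M / \<eta>\<^sup>2" using n by (simp add: field_simps)
    then have "l * \<bar>?R \<omega> - ?S\<bar> \<le> l * (\<bar>?D \<omega>\<bar> / n + 2 * M / \<eta>\<^sup>2)" using l by simp
    then show ?thesis by (simp add: algebra_simps)
  qed
  have "simple_function P (\<lambda>\<omega>. exp (l * \<bar>?R \<omega> - ?S\<bar>))"
    by (rule simple_function_compose1[OF simple_function_raw_estimator[OF i j]])
  then have int: "integrable P (\<lambda>\<omega>. exp (l * \<bar>?R \<omega> - ?S\<bar>))"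
    by (rule integrable_simple_function_real)
  have [measurable]: "summand i j k \<in> borel_measurable P" if "k \<in> {1..n}" for k
    using indep_vars_summand[OF i j] that unfolding indep_vars_def by blast
  have "ennreal (expectation (\<lambda>\<omega>. exp (l * \<bar>?R \<omega> - ?S\<bar>))) = (\<integral>\<^sup>+\<omega>. exp (l * \<bar>?R \<omega> - ?S\<bar>) \<partial>P)"
    by (rule nn_integral_eq_integral[OF int, symmetric]) simp
  also have "\<dots> \<le> (\<integral>\<^sup>+\<omega>. ennreal (exp (l * (2 * M / \<eta>\<^sup>2))) * ennreal (exp ((l / n) * \<bar>?D \<omega>\<bar>)) \<partial>P)"
    using le by (intro nn_integral_mono) (simp add: add.commute flip: ennreal_mult exp_add)
  also have "\<dots> = ennreal (exp (l * (2 * M / \<eta>\<^sup>2))) * (\<integral>\<^sup>+\<omega>. exp ((l / n) * \<bar>?D \<omega>\<bar>) \<partial>P)"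
    by (rule nn_integral_cmult) measurable
  also have "\<dots> \<le> ennreal (exp (l * (2 * M / \<eta>\<^sup>2))) * ennreal (2 * exp (card {1..n} * (l / n)\<^sup>2 * (\<gamma>\<^sup>2)\<^sup>2 / 2))"
    using l n
    by (intro mult_left_mono nn_integral_exp_abs_centered_sum_le[OF _ indep_vars_summand[OF i j] abs_summand_le]
        divide_pos_pos) simp_all
  also have "card {1..n} * (l / n)\<^sup>2 * (\<gamma>\<^sup>2)\<^sup>2 / 2 = l\<^sup>2 * \<gamma> ^ 4 / (2 * n)"
    using n by (simp add: power2_eq_square eval_nat_numeral field_simps)
  also have "ennreal (exp (l * (2 * M / \<eta>\<^sup>2))) * ennreal (2 * exp (l\<^sup>2 * \<gamma> ^ 4 / (2 * n)))
      = ennreal (2 * exp (l\<^sup>2 * \<gamma> ^ 4 / (2 * n) + l * (2 * M / \<eta>\<^sup>2)))"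
    by (simp add: exp_add mult_ac flip: ennreal_mult)
  finally show ?thesis by (subst (asm) ennreal_le_iff) simp_all
qed

end

section \<open>Choice of scales and the final bounds\<close>

context bounded_fourth_moment_sample
begin

text \<open>The bias \<open>2 * M / \<eta>\<^sup>2\<close> equals
  \<open>u * (2 / C3\<^sup>2)\<close>. The choice of \<open>l\<close> makes the fluctuation term
  \<open>9 / 2 * L\<close>, while subtracting \<open>l * C\<close> removes the bias and a further
  \<open>9 * L\<close>.\<close>

lemma expectation_exp_scaled_error_le:
  fixes m v C3 C4 C u L l :: real
  assumes i: "i \<in> {1..d}" and j: "j \<in> {1..d}"
    and pos: "0 < m" "0 < v" "0 < C3" "0 < C4"
    and M: "M = m ^ 4" and \<eta>: "\<eta> = C3 * m / v" and \<gamma>: "\<gamma> = C4 * m / v"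
    and u: "u = m\<^sup>2 * v\<^sup>2" and L: "L = n * v ^ 8" and l: "l = 3 * L / C4\<^sup>2"
    and C: "3 * C4\<^sup>2 + 2 / C3\<^sup>2 \<le> C"
  shows "expectation (\<lambda>\<omega>. exp (l * (\<bar>raw_estimator \<eta> \<gamma> n (\<lambda>k. X k \<omega>) (\<lambda>kj. \<Gamma> kj \<omega>) i j
      - centered_cov P (X 1) i j\<bar> / u - C))) \<le> 2 * exp (- (9 / 2) * L)"
proof -
  let ?e = "\<lambda>\<omega>. \<bar>raw_estimator \<eta> \<gamma> n (\<lambda>k. X k \<omega>) (\<lambda>kj. \<Gamma> kj \<omega>) i j - centered_cov P (X 1) i j\<bar>"
  have n: "0 < real n" using n_pos by simp
  have up: "0 < u" and Lp: "0 < L" using pos n by (simp_all add: u L)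
  then have lp: "0 < l" using pos by (simp add: l)
  have "expectation (\<lambda>\<omega>. exp (l * (?e \<omega> / u - C))) = expectation (\<lambda>\<omega>. exp (- l * C) * exp (l / u * ?e \<omega>))"
    by (simp add: right_diff_distrib flip: exp_add)
  also have "\<dots> = exp (- l * C) * expectation (\<lambda>\<omega>. exp (l / u * ?e \<omega>))"
    by simp
  also have "\<dots> \<le> exp (- l * C) * (2 * exp ((l / u)\<^sup>2 * \<gamma> ^ 4 / (2 * n) + l / u * (2 * M / \<eta>\<^sup>2)))"
    using lp up by (intro mult_left_mono expectation_exp_raw_estimator_error_le i j) auto
  also have "\<dots> = 2 * exp ((l / u)\<^sup>2 * \<gamma> ^ 4 / (2 * n) + l / u * (2 * M / \<eta>\<^sup>2) - l * C)"
    by (simp add: exp_diff exp_add exp_minus field_simps)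
  also have "(l / u)\<^sup>2 * \<gamma> ^ 4 / (2 * n) = 9 / 2 * L"
  proof -
    have "(l / u)\<^sup>2 * \<gamma> ^ 4 / (2 * n) = 9 * L * L / (2 * (n * v ^ 8))"
      using pos n by (simp add: l u \<gamma> field_simps power2_eq_square eval_nat_numeral)
    then show ?thesis using Lp by (simp flip: L)
  qed
  also have "l / u * (2 * M / \<eta>\<^sup>2) = l * (2 / C3\<^sup>2)"
    using pos by (simp add: u M \<eta> field_simps power2_eq_square eval_nat_numeral)
  also have "2 * exp (9 / 2 * L + l * (2 / C3\<^sup>2) - l * C) \<le> 2 * exp (- (9 / 2) * L)"
  proof -
    have "l * (3 * C4\<^sup>2 + 2 / C3\<^sup>2) \<le> l * C" using C lp by simp
    moreover have "l * (3 * C4\<^sup>2) = 9 * L" using pos by (simp add: l)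
    ultimately show ?thesis by (simp add: distrib_left)
  qed
  finally show ?thesis .
qed

text \<open>The single variable \<open>Z\<close> serves both claims: Markov's inequality for the
  probability, its mean for the moment. The exponent \<open>9 / 2 * (\<delta> * ln d)\<close> has to
  beat a factor \<open>d ^ 3\<close> from summing over the entries and, for the moment, also
  \<open>(real d)\<^sup>2 powr p\<close>.\<close>

lemma error_bounds:
  fixes m v C3 C4 C5 C u L l q s \<delta> :: real
  defines "err \<equiv> \<lambda>\<omega>. op_norm d (\<lambda>i j. cov_estimator \<eta> \<gamma> (C5 * u) n (\<lambda>k. X k \<omega>) (\<lambda>kj. \<Gamma> kj \<omega>) i j
      - centered_cov P (X 1) i j)"
  assumes pos: "0 < m" "0 < v" "0 < C3" "0 < C4"
    and M: "M = m ^ 4" and \<eta>: "\<eta> = C3 * m / v" and \<gamma>: "\<gamma> = C4 * m / v"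
    and u: "u = m\<^sup>2 * v\<^sup>2" and L: "\<delta> * ln d = n * v ^ 8"
    and C: "3 * C4\<^sup>2 + 2 / C3\<^sup>2 \<le> C" "1 \<le> C" and C5: "2 * C \<le> C5"
    and d: "2 \<le> d" and \<delta>: "4 \<le> \<delta>" and q: "0 \<le> q" "q < 1" and s: "0 < s"
    and sparse: "column_sparse d q s (centered_cov P (X 1))"
  shows "1 - exp (-\<delta>) \<le> prob {\<omega> \<in> space P. err \<omega> \<le> 4 * (1 + C5) * C * (s * u powr (1 - q))}"
    and "integrable P (\<lambda>\<omega>. err \<omega> powr (\<delta> / 4))"
    and "u powr q \<le> s \<Longrightarrow> expectation (\<lambda>\<omega>. err \<omega> powr (\<delta> / 4)) powr (1 / (\<delta> / 4))
      \<le> 4 * (1 + C5) * C * (s * u powr (1 - q))"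
proof -
  let ?R = "\<lambda>\<omega> i j. raw_estimator \<eta> \<gamma> n (\<lambda>k. X k \<omega>) (\<lambda>kj. \<Gamma> kj \<omega>) i j"
  let ?S = "centered_cov P (X 1)"
  define p where "p = \<delta> / 4"
  define l where "l = 3 * (\<delta> * ln d) / C4\<^sup>2"
  define T where "T = (\<lambda>i j \<omega>. exp (l * (\<bar>?R \<omega> i j - ?S i j\<bar> / u - C)))"
  define Z where "Z = (\<lambda>\<omega>. \<Sum>i=1..d. \<Sum>j=1..d. T i j \<omega>)"
  define r where "r = s * u powr (1 - q)"
  have up: "0 < u" using pos by (simp add: u)
  have p: "1 \<le> p" using \<delta> by (simp add: p_def)
  have r0: "0 < r" using s up by (simp add: r_def)
  \<comment> \<open>With \<open>ln d\<close> bounded away from 0, \<open>\<delta> * ln d\<close>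
    controls both \<open>p\<close> and the exponent \<open>\<delta>\<close> of the failure
    probability.\<close>
  have "2 / 3 \<le> ln (2::real)" by (rule ln2_ge_two_thirds)
  also have "\<dots> \<le> ln d" using d by simp
  finally have lnd: "2 / 3 \<le> ln (real d)" .
  have Lp: "2 / 3 * \<delta> \<le> \<delta> * ln d" using mult_left_mono[OF lnd, of \<delta>] \<delta> by simp
  have lp: "0 < l" using Lp \<delta> pos by (simp add: l_def)
  have pl: "p \<le> l * C"
  proof -
    have "l * (3 * C4\<^sup>2) \<le> l * (3 * C4\<^sup>2 + 2 / C3\<^sup>2)" using lp pos by (intro mult_left_mono) auto
    also have "\<dots> \<le> l * C" using C lp by (intro mult_left_mono) auto
    also have "l * (3 * C4\<^sup>2) = 9 * (\<delta> * ln d)" using pos by (simp add: l_def)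
    finally show ?thesis using Lp \<delta> unfolding p_def by linarith
  qed
  have col: "(\<Sum>i=1..d. \<bar>?S i j\<bar> powr q) \<le> s" if "j \<in> {1..d}" for j
  proof -
    have "(\<Sum>i=1..d. \<bar>?S i j\<bar> powr q) \<le> (SUP j\<in>{1..d}. \<Sum>i=1..d. \<bar>?S i j\<bar> powr q)"
      using that by (intro cSUP_upper bdd_above_finite) auto
    then show ?thesis using sparse unfolding column_sparse_def by linarith
  qed
  \<comment> \<open>Sparsity is given by columns but the Schur test also needs rows; symmetry
    supplies them.\<close>
  have sym: "?S i j = ?S j i" for i j by (simp add: centered_cov_def mult.commute)
  have row: "(\<Sum>j=1..d. \<bar>?S i j\<bar> powr q) \<le> s" if "i \<in> {1..d}" for i
    using col[OF that] by (subst sym)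
  have err: "err \<omega> = op_norm d (\<lambda>i j. hard_threshold (C5 * u) (?R \<omega> i j) - ?S i j)" for \<omega>
    by (simp add: err_def cov_estimator_def)
  have simple: "simple_function P err"
    unfolding err_def by (rule simple_function_op_norm_cov_estimator)
  have simpleT: "simple_function P (T i j)" if "i \<in> {1..d}" "j \<in> {1..d}" for i j
    unfolding T_def by (rule simple_function_compose1[OF simple_function_raw_estimator[OF that]])
  have intT: "integrable P (T i j)" if "i \<in> {1..d}" "j \<in> {1..d}" for i j
    by (rule integrable_simple_function_real[OF simpleT[OF that]])
  have intZ: "integrable P Z"
    unfolding Z_def by (intro Bochner_Integration.integrable_sum intT)
  have EZ: "expectation Z \<le> exp (3 * ln d - 9 / 2 * (\<delta> * ln d))"
  proof -
    have "expectation Z = (\<Sum>i=1..d. \<Sum>j=1..d. expectation (T i j))"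
      unfolding Z_def
      by (subst Bochner_Integration.integral_sum)
         (auto intro!: Bochner_Integration.integrable_sum sum.cong Bochner_Integration.integral_sum intT simp del: One_nat_def)
    also have "\<dots> \<le> (\<Sum>i=1..d. \<Sum>j=1..d. 2 * exp (- (9 / 2) * (\<delta> * ln d)))"
      unfolding T_def
      by (intro sum_mono expectation_exp_scaled_error_le[OF _ _ pos M \<eta> \<gamma> u L l_def C(1)])
    also have "\<dots> = 2 * (real d * real d * exp (- (9 / 2) * (\<delta> * ln d)))" by simp
    \<comment> \<open>The factor 2 is replaced by \<open>d\<close>, which makes the bound a pure
      exponential.\<close>
    also have "\<dots> \<le> real d * (real d * real d * exp (- (9 / 2) * (\<delta> * ln d)))"
      using d by (intro mult_right_mono) auto
    also have "\<dots> = exp (3 * ln d - 9 / 2 * (\<delta> * ln d))"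
    proof -
      have "exp (3 * ln (real d)) = real d * (real d * real d)"
        using d exp_of_nat_mult[of 3 "ln (real d)"] by (simp add: eval_nat_numeral)
      moreover have "exp (3 * ln d - 9 / 2 * (\<delta> * ln d)) = exp (3 * ln d) * exp (- (9 / 2) * (\<delta> * ln d))"
        by (simp flip: exp_add)
      ultimately show ?thesis by (simp only: mult.assoc)
    qed
    finally show ?thesis .
  qed
  \<comment> \<open>By \<open>4 \<le> \<delta>\<close> the factor \<open>d ^ 3\<close> uses up only
    \<open>3 / 4\<close> of the available \<open>9 / 2\<close>.\<close>
  have three: "3 * ln d \<le> 3 / 4 * (\<delta> * ln d)"
    using mult_right_mono[OF \<delta>, of "ln d"] lnd by simp

  show "1 - exp (-\<delta>) \<le> prob {\<omega> \<in> space P. err \<omega> \<le> 4 * (1 + C5) * C * (s * u powr (1 - q))}"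
    (is "_ \<le> prob ?G")
  proof -
    have [measurable]: "err \<in> borel_measurable P" "Z \<in> borel_measurable P"
      using simple intZ by (auto intro: borel_measurable_simple_function)
    \<comment> \<open>A single entry off by more than \<open>C * u\<close> already makes
      \<open>Z\<close> at least 1, so one use of Markov's inequality replaces a union bound.\<close>
    define B where "B = {\<omega> \<in> space P. 1 \<le> Z \<omega>}"
    have [measurable]: "B \<in> sets P" unfolding B_def by measurable
    have "prob B \<le> expectation Z / 1"
      unfolding B_def
      by (rule integral_Markov_inequality_measure[OF intZ, of "{}"])
         (auto simp: Z_def T_def sum_nonneg)
    also have "\<dots> \<le> exp (-\<delta>)"
    proof -
      have "3 * ln d - 9 / 2 * (\<delta> * ln d) \<le> - \<delta>" using three Lp \<delta> by linarith
      then have "exp (3 * ln d - 9 / 2 * (\<delta> * ln d)) \<le> exp (-\<delta>)" by simp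
      then show ?thesis using EZ by linarith
    qed
    finally have "1 - exp (-\<delta>) \<le> prob (space P - B)" by (simp add: prob_compl)
    also have "\<dots> \<le> prob ?G"
    proof (rule finite_measure_mono)
      show "space P - B \<subseteq> ?G"
      proof
        fix \<omega> assume \<omega>: "\<omega> \<in> space P - B"
        then have Z: "Z \<omega> < 1" by (auto simp: B_def)
        have close: "\<bar>?R \<omega> i j - ?S i j\<bar> \<le> C * u" if "i \<in> {1..d}" "j \<in> {1..d}" for i j
        proof (rule ccontr)
          assume "\<not> ?thesis"
          then have "0 \<le> l * (\<bar>?R \<omega> i j - ?S i j\<bar> / u - C)" using lp up by (simp add: field_simps)
          then have "1 \<le> T i j \<omega>" by (simp add: T_def)
          also have "\<dots> \<le> (\<Sum>j=1..d. T i j \<omega>)"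
            using that by (intro member_le_sum) (auto simp: T_def)
          also have "\<dots> \<le> Z \<omega>"
            unfolding Z_def using that
            by (intro member_le_sum[of i _ "\<lambda>i. \<Sum>j=1..d. T i j \<omega>"]) (auto simp: T_def intro!: sum_nonneg)
          finally show False using Z by simp
        qed
        have "err \<omega> \<le> (C + C5) * u powr (1 - q) * s"
          unfolding err using s
          by (intro op_norm_hard_threshold_error_le[OF up C(2) C5 q] row col close) auto
        also have "\<dots> = (C + C5) * r" by (simp add: r_def)
        also have "\<dots> \<le> 4 * (1 + C5) * C * r"
        proof -
          have "C5 \<le> C5 * C" "0 \<le> C5 * C" using C C5 by simp_all
          then have "C + C5 \<le> 4 * (1 + C5) * C" using C by (simp add: algebra_simps)
          then show ?thesis using r0 by (intro mult_right_mono) auto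
        qed
        finally show "\<omega> \<in> ?G" using \<omega> by (simp add: r_def)
      qed
    qed measurable
    finally show ?thesis .
  qed

  have int: "integrable P (\<lambda>\<omega>. err \<omega> powr p)"
    by (rule integrable_simple_function_real[OF simple_function_compose1[OF simple]])
  then show "integrable P (\<lambda>\<omega>. err \<omega> powr (\<delta> / 4))" by (simp only: p_def)

  assume sq: "u powr q \<le> s"
  define k where "k = 2 * (1 + C5) * C"
  have k0: "0 < k" using C C5 by (simp add: k_def)
  \<comment> \<open>The exceptional part carries \<open>u\<close> but no factor \<open>s\<close>;
    the condition on \<open>s\<close> is what compares it with the rate \<open>r\<close>.\<close>
  have "u = u powr q * u powr (1 - q)" using up by (simp flip: powr_add)
  also have "\<dots> \<le> r" unfolding r_def using sq by (intro mult_right_mono) auto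
  finally have ur: "u \<le> r" .
  have "expectation (\<lambda>\<omega>. err \<omega> powr p)
      \<le> expectation (\<lambda>\<omega>. (2 * ((C + C5) * u powr (1 - q) * s)) powr p
            + (2 * (1 + C5) * C * u * (real d)\<^sup>2) powr p * Z \<omega>)"
  proof (rule integral_mono[OF int])
    show "integrable P (\<lambda>\<omega>. (2 * ((C + C5) * u powr (1 - q) * s)) powr p
        + (2 * (1 + C5) * C * u * (real d)\<^sup>2) powr p * Z \<omega>)"
      using intZ by simp
    show "err \<omega> powr p \<le> (2 * ((C + C5) * u powr (1 - q) * s)) powr p
        + (2 * (1 + C5) * C * u * (real d)\<^sup>2) powr p * Z \<omega>" for \<omega>
      unfolding err Z_def T_def using p s
      by (intro op_norm_hard_threshold_error_powr_le[OF up C(2) C5 q _ pl] row col) auto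
  qed
  also have "\<dots> = (2 * ((C + C5) * u powr (1 - q) * s)) powr p
      + (2 * (1 + C5) * C * u * (real d)\<^sup>2) powr p * expectation Z"
    using intZ by (simp add: prob_space)
  also have "\<dots> \<le> (k * r) powr p + (k * r) powr p"
  proof (rule add_mono)
    have "C5 \<le> C5 * C" using C C5 by simp
    then have "2 * (C + C5) \<le> k" by (simp add: k_def algebra_simps)
    then have "2 * (C + C5) * r \<le> k * r" using r0 by (intro mult_right_mono) auto
    then have "(2 * (C + C5) * r) powr p \<le> (k * r) powr p"
      using p C C5 r0 by (intro powr_mono2) auto
    moreover have "2 * ((C + C5) * u powr (1 - q) * s) = 2 * (C + C5) * r" by (simp add: r_def)
    ultimately show "(2 * ((C + C5) * u powr (1 - q) * s)) powr p \<le> (k * r) powr p"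
      by (simp only:)
    have "(2 * (1 + C5) * C * u * (real d)\<^sup>2) powr p * expectation Z
        \<le> (k * u) powr p * exp (2 * p * ln d) * exp (3 * ln d - 9 / 2 * (\<delta> * ln d))"
    proof (rule mult_mono[OF _ EZ])
      have "(real d)\<^sup>2 powr p = exp (2 * p * ln d)"
        using d by (simp add: powr_def ln_realpow)
      then show "(2 * (1 + C5) * C * u * (real d)\<^sup>2) powr p \<le> (k * u) powr p * exp (2 * p * ln d)"
        unfolding k_def[symmetric] using k0 up by (subst powr_mult) auto
    qed (auto simp: Z_def T_def intro!: integral_nonneg_AE sum_nonneg)
    \<comment> \<open>Since \<open>2 * p = \<delta> / 2\<close>, the exponent \<open>9 / 2\<close>
      drops to 4, which still absorbs \<open>d ^ 3\<close>.\<close>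
    also have "\<dots> = (k * u) powr p * exp (3 * ln d - 4 * (\<delta> * ln d))"
      by (simp add: p_def mult.assoc flip: exp_add)
    also have "\<dots> \<le> (k * u) powr p * 1"
      using three Lp \<delta> by (intro mult_left_mono) auto
    also have "\<dots> \<le> (k * r) powr p"
      using p k0 up ur by (simp add: powr_mono2)
    finally show "(2 * (1 + C5) * C * u * (real d)\<^sup>2) powr p * expectation Z \<le> (k * r) powr p" .
  qed
  also have "\<dots> \<le> (2 * (k * r)) powr p"
  proof -
    \<comment> \<open>As \<open>1 \<le> p\<close>, two equal terms cost only a factor 2 after the
      \<open>p\<close>-th root, uniformly in \<open>p\<close>.\<close>
    have "2 * (k * r) powr p \<le> 2 powr p * (k * r) powr p"
      using powr_mono[OF p, of 2] by (intro mult_right_mono) auto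
    then show ?thesis using k0 r0 by (simp add: powr_mult)
  qed
  finally have "expectation (\<lambda>\<omega>. err \<omega> powr p) powr (1 / p) \<le> ((2 * (k * r)) powr p) powr (1 / p)"
    using p by (intro powr_mono2 integral_nonneg_AE) auto
  also have "\<dots> = 2 * (k * r)" using p k0 r0 by (simp add: powr_powr)
  finally show "expectation (\<lambda>\<omega>. err \<omega> powr (\<delta> / 4)) powr (1 / (\<delta> / 4))
      \<le> 4 * (1 + C5) * C * (s * u powr (1 - q))"
    unfolding k_def r_def p_def by (simp add: algebra_simps)
qed

end

text \<open>All constants precede the measure, the dimension and the sample. The moment bound needs
  \<open>s\<close> bounded below: for \<open>X = 0\<close> every \<open>s > 0\<close> is admissible,
  yet for small \<open>t\<close> the bits agree with positive probability and an entry
  \<open>\<gamma>\<^sup>2\<close> survives the threshold, so the moment stays positive as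
  \<open>s\<close> tends to 0.\<close>

theorem theorem6:
  fixes C3 C4 :: real
  assumes "0 < C3" and "C3 < C4"
  shows "\<exists>C5_min>0. \<forall>C5\<ge>C5_min. \<exists>c>0. \<exists>K>0.
    \<forall>(P :: 'a measure) (d :: nat) (n :: nat) (\<delta> :: real) (M :: real) (q :: real) (s :: real) X \<Gamma>.
      (let t = \<delta> * ln (real d) / real n;
           \<eta> = C3 * M powr (1/4) * (real n / (\<delta> * ln (real d))) powr (1/8);
           \<gamma> = C4 * M powr (1/4) * (real n / (\<delta> * ln (real d))) powr (1/8);
           \<zeta> = C5 * sqrt M * t powr (1/4);
           \<Sigma> = centered_cov P (X 1);
           err = (\<lambda>\<omega>. op_norm d
                   (\<lambda>i j. cov_estimator \<eta> \<gamma> \<zeta> n (\<lambda>k. X k \<omega>) (\<lambda>kj. \<Gamma> kj \<omega>) i j - \<Sigma> i j));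
           p = \<delta> / 4;
           rate = s * M powr ((1 - q) / 2) * t powr ((1 - q) / 4)
       in
         prob_space P \<and> 2 \<le> d \<and> 1 \<le> n \<and> 4 \<le> \<delta> \<and> 0 \<le> q \<and> q < 1 \<and> 0 < s \<and>
         iid_sample P d n X \<and>
         (\<forall>k\<in>{1..n}. \<forall>i\<in>{1..d}. (\<integral>\<omega>. X k \<omega> i \<partial>P) = 0) \<and>
         (\<forall>k\<in>{1..n}. \<forall>i\<in>{1..d}.
            integrable P (\<lambda>\<omega>. \<bar>X k \<omega> i\<bar> ^ 4) \<and> (\<integral>\<omega>. \<bar>X k \<omega> i\<bar> ^ 4 \<partial>P) \<le> M) \<and>
         column_sparse d q s \<Sigma> \<and>
         uniform_dithers P d n \<gamma> \<Gamma> \<and>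
         dithers_independent P d n X \<Gamma> \<and>
         t \<le> c
         \<longrightarrow>
         ((sqrt M * t powr (1/4)) powr q \<le> s \<longrightarrow>
            integrable P (\<lambda>\<omega>. err \<omega> powr p) \<and>
            (\<integral>\<omega>. err \<omega> powr p \<partial>P) powr (1/p) \<le> K * rate) \<and>
         measure P {\<omega> \<in> space P. err \<omega> \<le> K * rate} \<ge> 1 - exp (- \<delta>))"
proof -
  \<comment> \<open>The first two terms come from fluctuation and bias, and the last ensures
    \<open>1 \<le> C\<close>. Taking \<open>C5\<close> at least \<open>2 * C\<close> forces
    \<open>\<bar>\<sigma>\<bar> \<ge> C * u\<close> at every kept entry that is accurate to
    \<open>C * u\<close>.\<close>
  define C where "C = 3 * C4\<^sup>2 + 2 / C3\<^sup>2 + 1"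
  have C: "3 * C4\<^sup>2 + 2 / C3\<^sup>2 \<le> C" "1 \<le> C" by (simp_all add: C_def)
  have C4: "0 < C4" using assms by simp
  show ?thesis
  proof (rule exI[of _ "2 * C"], intro conjI allI impI, goal_cases)
    case 1
    then show ?case using C by simp
  next
    case (2 C5)
    then have C5: "2 * C \<le> C5" .
    define K where "K = 4 * (1 + C5) * C"
    show ?case
    proof (rule exI[of _ 1], rule conjI[OF zero_less_one], rule exI[of _ K], rule conjI, goal_cases)
      case 1
      show ?case unfolding K_def using C C5 by simp
    next
      case 2
      show ?case
      proof (intro allI, goal_cases)
        case (1 P d n \<delta> M q s X \<Gamma>)
        show ?case
          unfolding Let_def
        proof (rule impI, elim conjE, goal_cases)
          case 1
          note A = this
          define t where "t = \<delta> * ln (real d) / real n"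
          \<comment> \<open>In terms of \<open>m\<close> and \<open>v\<close>, where \<open>M = m ^ 4\<close> and \<open>t = v ^ 8\<close>, all scales are monomials.\<close>
          define v where "v = t powr (1 / 8)"
          define m where "m = M powr (1 / 4)"
          define u where "u = m\<^sup>2 * v\<^sup>2"
          have d: "0 < ln (real d)" using A(2) by simp
          have t0: "0 < t" unfolding t_def using d A(3,4) by simp
          then have v0: "0 < v" by (simp add: v_def)
          have v8: "v ^ 8 = t" using t0 by (simp add: v_def powr_powr flip: powr_realpow)
          have v2: "v\<^sup>2 = t powr (1 / 4)" using t0 by (simp add: v_def powr_powr flip: powr_realpow)
          have inv: "(real n / (\<delta> * ln (real d))) powr (1 / 8) = 1 / v"
          proof -
            have "real n / (\<delta> * ln (real d)) = 1 / t" by (simp add: t_def)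
            then show ?thesis using t0 by (simp add: v_def powr_divide)
          qed
          interpret prob_space P by (rule A(1))
          have M0: "0 \<le> M"
          proof -
            have "0 \<le> (\<integral>\<omega>. \<bar>X 1 \<omega> 1\<bar> ^ 4 \<partial>P)" by simp
            also have "\<dots> \<le> M" using A(2,3,10) by simp
            finally show ?thesis .
          qed
          have "M \<noteq> 0"
          proof
            assume "M = 0"
            then have "distr P (borel_vec d) (\<Gamma> (1, 1)) = uniform_cube d 0"
              using A(3,12) by (simp add: uniform_dithers_def)
            moreover have "prob_space (distr P (borel_vec d) (\<Gamma> (1, 1)))"
              using A(3,12) unfolding uniform_dithers_def indep_vars_def by (intro prob_space_distr) simp
            ultimately show False
              using emeasure_uniform_cube_0[of d] A(2) prob_space.emeasure_space_1 by fastforce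
          qed
          then have Mp: "0 < M" using M0 by simp
          then have m0: "0 < m" by (simp add: m_def)
          have m4: "M = m ^ 4" using Mp by (simp add: m_def powr_powr flip: powr_realpow)
          have m2: "sqrt M = m\<^sup>2" by (rule real_sqrt_unique) (simp_all add: m4)
          have rate: "s * M powr ((1 - q) / 2) * t powr ((1 - q) / 4) = s * u powr (1 - q)"
          proof -
            have "M powr ((1 - q) / 2) = (M powr (1 / 2)) powr (1 - q)" by (simp add: powr_powr)
            moreover have "t powr ((1 - q) / 4) = (t powr (1 / 4)) powr (1 - q)" by (simp add: powr_powr)
            ultimately show ?thesis
              using Mp by (simp add: u_def v2 powr_half_sqrt m2 powr_mult)
          qed
          have \<eta>: "C3 * M powr (1 / 4) * (real n / (\<delta> * ln (real d))) powr (1 / 8) = C3 * m / v"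
            and \<gamma>: "C4 * M powr (1 / 4) * (real n / (\<delta> * ln (real d))) powr (1 / 8) = C4 * m / v"
            by (simp_all add: inv m_def)
          have \<zeta>: "C5 * sqrt M * t powr (1 / 4) = C5 * u" by (simp add: u_def v2 m2)
          have u: "sqrt M * t powr (1 / 4) = u" by (simp add: u_def v2 m2)
          have L: "\<delta> * ln (real d) = n * v ^ 8" using A(3) by (simp add: v8 t_def)
          interpret bounded_fourth_moment_sample P d n "C4 * m / v" "C3 * m / v" X \<Gamma> M
          proof
            show "0 < C3 * m / v" using assms m0 v0 by simp
            show "C3 * m / v < C4 * m / v" using assms m0 v0 by (simp add: divide_strict_right_mono)
            show "uniform_dithers P d n (C4 * m / v) \<Gamma>" using A(12) by (simp only: \<gamma>)
          qed (use A in auto)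
          note bounds = error_bounds[OF m0 v0 assms(1) C4 m4 refl refl u_def L C C5 A(2,4,5,6,7,11)]
          show ?case
            unfolding t_def[symmetric] \<eta> \<gamma> \<zeta> u rate K_def
            using bounds by blast
        qed
      qed
    qed
  qed
qed

end
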